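(* Let $r>2$ be an integer and let $p$ be the smallest odd prime dividing $r$ (if $r$ is a power of $2$, so that no such $p$ exists, $\min\{6,p+1\}$ is read as $6$). Then $$\widetilde\varphi(r)=\begin{cases} p+1, & 4\nmid r,\\ \min\{6,p+1\}, & 4\mid r.\end{cases}$$
   Context: $\mathbb N$ denotes the positive integers. For an integer $r>2$, $Z_r=(\mathbb Z/r\mathbb Z)^*$ is the group of units modulo $r$, and $[a]_r\in\{0,\dots,r-1\}$ is the residue of $a$ modulo $r$. For $\overline m=(m_1,\dots,m_n)\in (Z_r)^n$ let $\mathsf N_{(r;\overline m)}$ be the directed graph with vertices $c_{s,t}$ ($1\le s\le n$, $0\le t<r$), where the vertices $c_{s,0}$ are called 0-vertices, and with directed edges $c_{s,t}\to c_{s+1,t}$ (for $1\le s<n$) and $c_{s,t}\to c_{s,[t+m_s]_r}$. Let $\mathsf B_{(r;\overline m)}$ be the $n\times n$ integer matrix whose entry $\langle i,j\rangle$ is the number of directed paths (finite walks) in $\mathsf N_{(r;\overline m)}$ from $c_{i,0}$ to $c_{j,0}$ such that (i) the path visits at least one vertex that is not a 0-vertex, and (ii) whenever the path visits a 0-vertex after its starting position, all subsequent vertices of the path are 0-vertices. For integer $n\times n$ matrices $C,D$ write $C\cong D$ if there exist upper triangular integer matrices $X,Y$ with all diagonal entries equal to $1$ such that $XC=DY$. Write $A\sim B$ if $A-I\cong B-I$; this is an equivalence relation. For $n\in\mathbb N$ let $S_{r,n}=\{\mathsf B_{(r;\overline m)}\mid \overline m\in (Z_r)^n\}$, let $\varphi_r(n)$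 be the number of $\sim$-equivalence classes of $S_{r,n}$, and let $\widetilde\varphi(r)$ be the least $n$ such that $\varphi_r(n)>1$. *)

theory Defs
  imports
    "HOL-Number_Theory.Residues"
    "HOL-Library.FuncSet"
    "Graph_Theory.Pair_Digraph"
    "Graph_Theory.Vertex_Walk"
    "Jordan_Normal_Form.Matrix"
begin

definition unit_tuples :: "nat \<Rightarrow> nat \<Rightarrow> (nat \<Rightarrow> int) set" where
  "unit_tuples r n = {1..n} \<rightarrow>\<^sub>E Units (residue_ring (int r))"

text \<open>The vertex \<open>c\<^sub>s\<^sub>,\<^sub>t\<close> is the pair \<open>(s, t)\<close>.
  For \<open>r > 2\<close> no two of the edges described below are parallel, so a set of pairs records them
  faithfully and a directed path is determined by its list of vertices.\<close>

definition lens_graph :: "nat \<Rightarrow> nat \<Rightarrow> (nat \<Rightarrow> int) \<Rightarrow> (nat \<times> int) pair_pre_digraph" where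
  "lens_graph r n m = \<lparr>
     pverts = {1..n} \<times> {0..<int r},
     parcs = {((s, t), (s + 1, t)) | s t. 1 \<le> s \<and> s < n \<and> t \<in> {0..<int r}}
           \<union> {((s, t), (s, (t + m s) mod int r)) | s t. 1 \<le> s \<and> s \<le> n \<and> t \<in> {0..<int r}} \<rparr>"

definition zero_vertex :: "nat \<times> int \<Rightarrow> bool" where
  "zero_vertex v \<longleftrightarrow> snd v = 0"

definition admissible_paths ::
  "nat \<Rightarrow> nat \<Rightarrow> (nat \<Rightarrow> int) \<Rightarrow> nat \<Rightarrow> nat \<Rightarrow> (nat \<times> int) vwalk set" where
  "admissible_paths r n m i j =
     {p. vwalk p (with_proj (lens_graph r n m)) \<and> hd p = (i, 0) \<and> last p = (j, 0) \<and>
         (\<exists>v \<in> set p. \<not> zero_vertex v) \<and>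
         (\<forall>k l. 0 < k \<and> k < l \<and> l < length p \<and> zero_vertex (p ! k) \<longrightarrow> zero_vertex (p ! l))}"

text \<open>Matrices of type \<open>int mat\<close> are indexed from 0, the rows of the graph from 1.\<close>

definition B_mat :: "nat \<Rightarrow> nat \<Rightarrow> (nat \<Rightarrow> int) \<Rightarrow> int mat" where
  "B_mat r n m = mat n n (\<lambda>(i, j). int (card (admissible_paths r n m (i + 1) (j + 1))))"

definition unitriangular :: "nat \<Rightarrow> int mat set" where
  "unitriangular n =
     {X \<in> carrier_mat n n. upper_triangular X \<and> (\<forall>i < n. X $$ (i, i) = 1)}"

definition mat_cong :: "nat \<Rightarrow> int mat \<Rightarrow> int mat \<Rightarrow> bool" where
  "mat_cong n C D \<longleftrightarrow> (\<exists>X \<in> unitriangular n. \<exists>Y \<in> unitriangular n. X * C = D * Y)"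

definition mat_sim :: "nat \<Rightarrow> int mat \<Rightarrow> int mat \<Rightarrow> bool" where
  "mat_sim n A B \<longleftrightarrow> mat_cong n (A - 1\<^sub>m n) (B - 1\<^sub>m n)"

definition S_set :: "nat \<Rightarrow> nat \<Rightarrow> int mat set" where
  "S_set r n = B_mat r n ` unit_tuples r n"

definition phi :: "nat \<Rightarrow> nat \<Rightarrow> nat" where
  "phi r n = card (S_set r n // {(A, B). A \<in> S_set r n \<and> B \<in> S_set r n \<and> mat_sim n A B})"

definition phi_tilde :: "nat \<Rightarrow> nat" where
  "phi_tilde r = (LEAST n. 0 < n \<and> 1 < phi r n)"

end

theory Submission
  imports Defs "HOL-Computational_Algebra.Polynomial"
begin

text \<open>Measuring the position on level \<open>s\<close> in multiples of \<open>m\<^sub>s\<close>, an admissible path becomes a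
  weakly increasing chain whose entries are rescaled by the ratios \<open>w\<^sub>s = m\<^sub>s / m\<^sub>s\<^sub>+\<^sub>1\<close> between
  consecutive levels; this gives a recursion for the entries of \<open>B - I\<close>. Modulo a divisor \<open>k\<close> of
  \<open>r\<close> coprime to \<open>d!\<close> the counts on the \<open>d\<close>-th diagonal are polynomials in the starting position
  which vanish at position 1, where every path starts, so these diagonals are divisible by \<open>k\<close>.
  Hence up to size \<open>p\<close> everything can be cleared by unitriangular operations, except for the powers of two in \<open>r\<close>:
  if \<open>r = 2k\<close>, the second diagonal is an odd multiple of \<open>k\<close> and serves as a further pivot; if
  \<open>4 dvd r\<close>, the third and fourth diagonals are computed explicitly modulo the 2-part of \<open>r\<close>.

  In size \<open>p + 1\<close> the corner modulo the odd part \<open>k\<close> of \<open>r\<close> is an invariant. Replacing \<open>m\<^sub>2 = 1\<close>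
  by \<open>-1\<close> changes the sign of the corner \<open>binomial (r + p - 1) p\<close> modulo \<open>r\<close>, and \<open>k\<close> does not
  divide it. In size 6 with \<open>4 dvd r\<close> and 2-part \<open>R\<close> of \<open>r\<close>, the corner modulo \<open>R / 2\<close> is an
  invariant, and it separates \<open>(1, 1, 1, 1, 1, 1)\<close> from \<open>(1, -1, -1, 1, 1, 1)\<close>.\<close>

section \<open>Counting admissible paths\<close>

text \<open>The representative of \<open>a\<close> modulo \<open>r\<close> in \<open>{1..r}\<close>: the residue 0 is encoded as \<open>r\<close>, since
  a 0-vertex is the last position that a walk can reach on its level.\<close>

definition rep :: "nat \<Rightarrow> int \<Rightarrow> nat" where
  "rep r a = nat ((a - 1) mod int r) + 1"

text \<open>For \<open>w s = m s / m (s + 1)\<close>, \<open>chain_count r w d s x\<close> counts the walks from the vertex with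
  second coordinate \<open>x * m s\<close> on level \<open>s\<close> to the 0-vertex of level \<open>s + d\<close> that never leave the
  0-vertices again; the summation variable is the position where the walk leaves level \<open>s\<close>.\<close>

primrec chain_count :: "nat \<Rightarrow> (nat \<Rightarrow> int) \<Rightarrow> nat \<Rightarrow> nat \<Rightarrow> nat \<Rightarrow> int" where
  "chain_count r w 0 s x = 1"
| "chain_count r w (Suc d) s x = (\<Sum>y = x..r. chain_count r w d (Suc s) (rep r (int y * w s)))"

lemma rep_range: "r > 0 \<Longrightarrow> rep r a \<in> {1..r}"
  by (auto simp: rep_def) (metis Suc_leI nat_less_iff of_nat_0_less_iff pos_mod_bound pos_mod_sign)

lemma int_rep: "r > 0 \<Longrightarrow> int (rep r a) = (a - 1) mod int r + 1"
  by (simp add: rep_def)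

lemma rep_cong: "r > 0 \<Longrightarrow> [int (rep r a) = a] (mod int r)"
  by (simp add: int_rep cong_def) (metis add.commute diff_add_cancel mod_add_right_eq)

lemma rep_eqI:
  assumes "r > 0" "x \<in> {1..r}" "[int x = a] (mod int r)"
  shows "rep r a = x"
proof -
  have "[int (rep r a) = int x] (mod int r)"
    using rep_cong[OF assms(1), of a] assms(3) cong_sym cong_trans by blast
  hence "[int (rep r a) - 1 = int x - 1] (mod int r)" by (simp add: cong_diff)
  moreover have "0 \<le> int (rep r a) - 1" "int (rep r a) - 1 < int r"
    using rep_range[OF assms(1), of a] by auto
  ultimately have "int (rep r a) - 1 = int x - 1"
    using assms(2) by (simp add: cong_def)
  thus ?thesis by simp
qed

lemma rep_id: "r > 0 \<Longrightarrow> x \<in> {1..r} \<Longrightarrow> rep r (int x) = x"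
  by (rule rep_eqI) auto

lemma rep_multiple:
  assumes "r > 0" shows "rep r (int r * a) = r"
  by (rule rep_eqI) (use assms in \<open>auto simp: cong_def\<close>)

text \<open>Position \<open>r\<close> is the 0-vertex, which every rescaling fixes, so the only walk
  left goes straight down through the 0-vertices.\<close>

lemma chain_count_last: "r > 0 \<Longrightarrow> chain_count r w d s r = 1"
  by (induction d arbitrary: s) (auto simp: rep_multiple)

text \<open>Here the condition on 0-vertices covers the starting vertex too, unlike in
  \<open>admissible_paths\<close>. This makes it hereditary under removing the first vertex, which
  the recursion needs.\<close>

definition good_walks :: "nat \<Rightarrow> nat \<Rightarrow> (nat \<Rightarrow> int) \<Rightarrow> nat \<Rightarrow> nat \<times> int \<Rightarrow> (nat \<times> int) vwalk set" where
  "good_walks r n m j v =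
     {p. vwalk p (with_proj (lens_graph r n m)) \<and> hd p = v \<and> last p = (j, 0) \<and>
         (\<forall>k l. k < l \<and> l < length p \<and> zero_vertex (p ! k) \<longrightarrow> zero_vertex (p ! l))}"

section \<open>Decomposition of walks at their first step\<close>

lemma pverts_lens [simp]: "pverts (lens_graph r n m) = {1..n} \<times> {0..<int r}"
  by (simp add: lens_graph_def)

lemma vwalk_single [simp]: "vwalk [v] G \<longleftrightarrow> v \<in> verts G"
  by (simp add: vwalk_def)

lemma vwalk_Cons [simp]:
  "vwalk (v # u # p) G \<longleftrightarrow> v \<in> verts G \<and> (v, u) \<in> arcs_ends G \<and> vwalk (u # p) G"
  by (auto simp: vwalk_def)

lemma all_later_Cons:
  "(\<forall>k l. k < l \<and> l < length (v # p) \<and> Z ((v # p) ! k) \<longrightarrow> Z ((v # p) ! l)) \<longleftrightarrow>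
   (Z v \<longrightarrow> (\<forall>u \<in> set p. Z u)) \<and> (\<forall>k l. k < l \<and> l < length p \<and> Z (p ! k) \<longrightarrow> Z (p ! l))"
  (is "?L \<longleftrightarrow> ?R")
proof
  assume L: ?L
  have "Z u" if u: "Z v" "u \<in> set p" for u
  proof -
    obtain i where "i < length p" "u = p ! i" using u by (auto simp: in_set_conv_nth)
    thus ?thesis using L[rule_format, of 0 "Suc i"] u by auto
  qed
  moreover have "Z (p ! l)" if "k < l" "l < length p" "Z (p ! k)" for k l
    using L[rule_format, of "Suc k" "Suc l"] that by auto
  ultimately show ?R by blast
next
  assume R: ?R
  show ?L
  proof (intro allI impI, elim conjE)
    fix k l assume *: "k < l" "l < length (v # p)" "Z ((v # p) ! k)"
    then obtain l' where l: "l = Suc l'" by (cases l) auto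
    show "Z ((v # p) ! l)"
    proof (cases k)
      case 0
      then show ?thesis using R * l by auto
    next
      case (Suc k')
      then show ?thesis using R * l by auto
    qed
  qed
qed

text \<open>Dropping the first vertex, which the definition of admissible paths exempts, turns their
  condition into the one of \<open>good_walks\<close>.\<close>

lemma all_later_positive_Cons:
  "(\<forall>k l. 0 < k \<and> k < l \<and> l < length (v # p) \<and> Z ((v # p) ! k) \<longrightarrow> Z ((v # p) ! l)) \<longleftrightarrow>
   (\<forall>k l. k < l \<and> l < length p \<and> Z (p ! k) \<longrightarrow> Z (p ! l))" (is "?L \<longleftrightarrow> ?R")
proof
  assume L: ?L
  show ?R
  proof (intro allI impI, elim conjE)
    fix k l assume "k < l" "l < length p" "Z (p ! k)"
    thus "Z (p ! l)" using L[rule_format, of "Suc k" "Suc l"] by auto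
  qed
next
  assume R: ?R
  show ?L
  proof (intro allI impI, elim conjE)
    fix k l assume *: "0 < k" "k < l" "l < length (v # p)" "Z ((v # p) ! k)"
    obtain k' l' where "k = Suc k'" "l = Suc l'"
      using * by (metis gr0_implies_Suc less_trans)
    thus "Z ((v # p) ! l)" using R * by auto
  qed
qed

text \<open>The units are given on all levels, not only on \<open>{1..n}\<close>, so that ratios and
  chain counts do not refer to the size; \<open>unit_tuples_eq\<close> passes to tuples of length
  \<open>n\<close>.\<close>

locale units_tuple =
  fixes r :: nat and m :: "nat \<Rightarrow> int"
  assumes r2: "r > 2" and unit: "0 < m s" "m s < int r" "coprime (m s) (int r)"
begin

lemma r0: "r > 0" using r2 by simp

lemma zero_step [simp]: "m s mod int r = m s" "m s \<noteq> 0"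
  using unit[of s] by auto

lemma arc_iff:
  assumes "s \<in> {1..n}" "t \<in> {0..<int r}"
  shows "((s, t), u) \<in> parcs (lens_graph r n m) \<longleftrightarrow>
    (s < n \<and> u = (Suc s, t)) \<or> u = (s, (t + m s) mod int r)"
  using assms by (auto simp: lens_graph_def)

lemma good_walks_too_deep:
  assumes "j < s" shows "good_walks r n m j (s, t) = {}"
proof -
  have "fst (hd p) \<le> fst (last p)" if "vwalk p (with_proj (lens_graph r n m))" for p
    using that
  proof (induction p rule: vwalk_arcs.induct)
    case (3 x y xs)
    have "fst x \<le> fst y" using 3 by (auto simp: lens_graph_def)
    thus ?case using 3 by simp
  qed (auto simp: vwalk_def)
  thus ?thesis using assms by (force simp: good_walks_def)
qed

lemma good_walks_Cons:
  assumes "v \<in> {1..n} \<times> {0..<int r}"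
  shows "v # p \<in> good_walks r n m j v \<longleftrightarrow> (p = [] \<and> v = (j, 0)) \<or>
    (p \<noteq> [] \<and> (v, hd p) \<in> parcs (lens_graph r n m) \<and> p \<in> good_walks r n m j (hd p) \<and>
      (zero_vertex v \<longrightarrow> (\<forall>u \<in> set p. zero_vertex u)))"
proof (cases p)
  case Nil
  then show ?thesis using assms by (auto simp: good_walks_def)
next
  case (Cons u q)
  show ?thesis
    unfolding good_walks_def mem_Collect_eq all_later_Cons using assms Cons by auto
qed

lemma good_walks_nonempty: "p \<in> good_walks r n m j v \<Longrightarrow> \<exists>q. p = v # q"
  by (cases p) (auto simp: good_walks_def vwalk_def)

lemma good_walks_zero_all:
  assumes "p \<in> good_walks r n m j v" "zero_vertex v" shows "\<forall>u \<in> set p. zero_vertex u"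
proof -
  obtain q where p: "p = v # q" using good_walks_nonempty assms by blast
  show ?thesis
    using assms(1) unfolding p good_walks_def mem_Collect_eq all_later_Cons using assms(2) by simp
qed

lemma good_walks_nonzero:
  assumes "s \<in> {1..n}" "t \<in> {0..<int r}" "t \<noteq> 0"
  shows "good_walks r n m j (s, t) = (#) (s, t) ` (good_walks r n m j (s, (t + m s) mod int r) \<union> (if s < n then good_walks r n m j (Suc s, t) else {}))"
    (is "_ = (#) ?v ` (?A \<union> ?B)")
proof (intro equalityI subsetI)
  fix p assume p: "p \<in> good_walks r n m j ?v"
  then obtain q where q: "p = ?v # q" using good_walks_nonempty by blast
  have "q \<in> ?A \<union> ?B"
    using p q good_walks_Cons[where v = ?v and p = q and j = j and n = n] assms by (auto simp: arc_iff zero_vertex_def)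
  thus "p \<in> (#) ?v ` (?A \<union> ?B)" using q by blast
next
  fix p assume "p \<in> (#) ?v ` (?A \<union> ?B)"
  then obtain q where q: "p = ?v # q" "q \<in> ?A \<union> ?B" by blast
  then obtain v' where v': "q \<in> good_walks r n m j v'" "(?v, v') \<in> parcs (lens_graph r n m)"
    using assms by (auto simp: arc_iff split: if_splits)
  moreover obtain q' where "q = v' # q'" using good_walks_nonempty v' by blast
  ultimately show "p \<in> good_walks r n m j ?v"
    using good_walks_Cons[where v = ?v and p = q and j = j and n = n] assms q by (auto simp: zero_vertex_def)
qed

text \<open>As \<open>m s\<close> is not 0, the arc along the level leaves the 0-vertices. Hence a
  walk at a 0-vertex can only stop or step down.\<close>

lemma good_walks_zero:
  assumes "s \<in> {1..n}"
  shows "good_walks r n m j (s, 0) = (if s = j then {[(s, 0)]} else {}) \<union> (#) (s, 0) ` (if s < n then good_walks r n m j (Suc s, 0) else {})"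
    (is "_ = ?A \<union> (#) ?v ` ?B")
proof (intro equalityI subsetI)
  fix p assume p: "p \<in> good_walks r n m j ?v"
  then obtain q where q: "p = ?v # q" using good_walks_nonempty by blast
  show "p \<in> ?A \<union> (#) ?v ` ?B"
  proof (cases "q = []")
    case True
    then show ?thesis using p q good_walks_Cons[where v = ?v and p = q and j = j and n = n] assms r0 by auto
  next
    case False
    then have *: "(?v, hd q) \<in> parcs (lens_graph r n m)" "q \<in> good_walks r n m j (hd q)" "\<forall>u\<in>set q. zero_vertex u"
      using p q good_walks_Cons[where v = ?v and p = q and j = j and n = n] assms r0 by (auto simp: zero_vertex_def)
    from *(3) False have "zero_vertex (hd q)" by auto
    with * show ?thesis using q assms r0 by (auto simp: arc_iff zero_vertex_def)
  qed
next
  fix p assume "p \<in> ?A \<union> (#) ?v ` ?B"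
  then consider "s = j" "p = [?v]" | q where "p = ?v # q" "s < n" "q \<in> good_walks r n m j (Suc s, 0)"
    by (auto split: if_splits)
  then show "p \<in> good_walks r n m j ?v"
  proof cases
    case 1
    then show ?thesis using good_walks_Cons[where v = ?v and p = "[]" and j = j and n = n] assms r0 by auto
  next
    case 2
    have "\<forall>u\<in>set q. zero_vertex u" using good_walks_zero_all 2 by (simp add: zero_vertex_def)
    moreover obtain q' where "q = (Suc s, 0) # q'" using good_walks_nonempty 2 by blast
    ultimately show ?thesis using good_walks_Cons[where v = ?v and p = q and j = j and n = n] assms r0 2 by (auto simp: arc_iff)
  qed
qed

lemma card_good_walks_zero:
  assumes "s \<in> {1..n}" "s \<le> j" "j \<le> n"
  shows "card (good_walks r n m j (s, 0)) = 1"
  using assms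
proof (induction "j - s" arbitrary: s)
  case 0
  then show ?case using good_walks_zero[where s = s and j = j and n = n] good_walks_too_deep[of j "Suc s"] by auto
next
  case (Suc d)
  then have "card (good_walks r n m j (Suc s, 0)) = 1" by auto
  then show ?case
    using good_walks_zero[where s = s and j = j and n = n] Suc by (auto simp: card_image)
qed

definition inverse_unit :: "nat \<Rightarrow> int" where
  "inverse_unit s = (SOME a. [m s * a = 1] (mod int r))"

definition ratio :: "nat \<Rightarrow> int" where
  "ratio s = m s * inverse_unit (Suc s)"

lemma inverse_unit: "[m s * inverse_unit s = 1] (mod int r)"
proof -
  have "\<exists>a. [m s * a = 1] (mod int r)" using unit by (intro cong_solve_coprime_int) auto
  thus ?thesis unfolding inverse_unit_def by (rule someI_ex)
qed

lemma coprime_ratio: "coprime (ratio s) (int r)"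
proof -
  have "coprime (inverse_unit (Suc s)) (int r)"
    using inverse_unit[of "Suc s"] by (metis coprime_mult_left_iff coprime_1_left cong_imp_coprime cong_sym)
  thus ?thesis unfolding ratio_def using unit by auto
qed

text \<open>A step down keeps the second coordinate and only changes the unit in which it is
  measured, from \<open>m s\<close> to \<open>m (Suc s)\<close>.\<close>

lemma rep_ratio: "[int (rep r (a * ratio s)) * m (Suc s) = a * m s] (mod int r)"
proof -
  have "[int (rep r (a * ratio s)) * m (Suc s) = (a * ratio s) * m (Suc s)] (mod int r)"
    by (intro cong_mult rep_cong r0 cong_refl)
  also have "(a * ratio s) * m (Suc s) = (a * m s) * (m (Suc s) * inverse_unit (Suc s))"
    by (simp add: ratio_def)
  also have "[\<dots> = a * m s * 1] (mod int r)"
    by (intro cong_mult inverse_unit cong_refl)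
  finally show ?thesis by simp
qed

lemma position_nonzero:
  assumes "x \<in> {1..<r}" shows "(int x * m s) mod int r \<noteq> 0"
proof
  assume "(int x * m s) mod int r = 0"
  hence "int r dvd int x * m s" by auto
  moreover have "coprime (int r) (m s)" using unit[of s] by (simp add: coprime_commute)
  ultimately have "int r dvd int x" using coprime_dvd_mult_left_iff by blast
  thus False using assms zdvd_imp_le[of "int r" "int x"] by auto
qed

text \<open>The outer induction is on the number of levels to descend, the inner one on the distance
  \<open>r - x\<close> to the 0-vertex. A walk at position \<open>x\<close> either descends there or
  moves on to \<open>x + 1\<close>, which matches splitting off the first summand of
  \<open>chain_count\<close>.\<close>

lemma card_good_walks:
  assumes "s \<in> {1..n}" "s + d \<le> n" "x \<in> {1..r}"
  shows "int (card (good_walks r n m (s + d) (s, (int x * m s) mod int r))) = chain_count r ratio d s x"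
  using assms
proof (induction d arbitrary: s x)
  case 0
  from 0 show ?case
  proof (induction "r - x" arbitrary: x)
    case 0
    then have "x = r" by simp
    then show ?case using card_good_walks_zero[where s = s and j = s and n = n] 0 by simp
  next
    case (Suc k)
    let ?t = "(int x * m s) mod int r"
    have "?t \<noteq> 0" "?t \<in> {0..<int r}"
      using Suc r0 position_nonzero[of x s] by auto
    moreover have "(?t + m s) mod int r = int (Suc x) * m s mod int r"
      by (simp add: mod_add_right_eq mod_add_left_eq algebra_simps)
    moreover have "int (card (good_walks r n m (s + 0) (s, int (Suc x) * m s mod int r))) = chain_count r ratio 0 s (Suc x)"
      using Suc by (intro Suc.hyps(1)) auto
    ultimately show ?case
      using good_walks_nonzero[where s = s and t = ?t and j = s and n = n] good_walks_too_deep[of s "Suc s"] Suc by (auto simp: card_image)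
  qed
next
  case (Suc d)
  note IH = Suc.IH
  from Suc.prems show ?case
  proof (induction "r - x" arbitrary: x)
    case 0
    then have "x = r" by simp
    then show ?case using card_good_walks_zero[where s = s and j = "s + Suc d" and n = n] 0 r0
      by (simp add: chain_count_last rep_multiple)
  next
    case (Suc k)
    let ?t = "(int x * m s) mod int r" and ?j = "s + Suc d"
    let ?x = "rep r (int x * ratio s)"
    have t: "?t \<noteq> 0" "?t \<in> {0..<int r}"
      using Suc r0 position_nonzero[of x s] by auto
    have next_t: "(?t + m s) mod int r = int (Suc x) * m s mod int r"
      by (simp add: mod_add_right_eq mod_add_left_eq algebra_simps)
    have right: "int (card (good_walks r n m ?j (s, int (Suc x) * m s mod int r))) = chain_count r ratio (Suc d) s (Suc x)"
      using Suc by (intro Suc.hyps(1)) auto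
    have "int (card (good_walks r n m (Suc s + d) (Suc s, (int ?x * m (Suc s)) mod int r))) = chain_count r ratio d (Suc s) ?x"
      using Suc rep_range[OF r0, of "int x * ratio s"] by (intro IH) auto
    moreover have "(int ?x * m (Suc s)) mod int r = ?t"
      using rep_ratio[of "int x" s] by (simp add: cong_def)
    ultimately have down: "int (card (good_walks r n m ?j (Suc s, ?t))) = chain_count r ratio d (Suc s) ?x" by simp
    \<comment> \<open>Since \<open>card\<close> is 0 on infinite sets, positive counts yield the
      finiteness needed for the cardinality of the disjoint union.\<close>
    have pos: "chain_count r ratio d' s' y > 0" if "y \<in> {1..r}" for d' s' y
      using that
    proof (induction d' arbitrary: s' y)
      case (Suc d')
      then show ?case using rep_range[OF r0] by (auto intro!: sum_pos)
    qed simp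
    have fin: "finite (good_walks r n m ?j (s, int (Suc x) * m s mod int r))" "finite (good_walks r n m ?j (Suc s, ?t))"
      using pos[of "Suc x" "Suc d" s] pos[of ?x d "Suc s"] right down Suc rep_range[OF r0, of "int x * ratio s"]
      by (intro card_ge_0_finite, force)+
    have disj: "good_walks r n m ?j (s, int (Suc x) * m s mod int r) \<inter> good_walks r n m ?j (Suc s, ?t) = {}"
      by (auto simp: good_walks_def)
    have "good_walks r n m ?j (s, ?t) = (#) (s, ?t) ` (good_walks r n m ?j (s, int (Suc x) * m s mod int r) \<union> good_walks r n m ?j (Suc s, ?t))"
      using good_walks_nonzero[where s = s and t = ?t and j = ?j and n = n] t Suc by (simp add: next_t)
    hence "int (card (good_walks r n m ?j (s, ?t))) = chain_count r ratio (Suc d) s (Suc x) + chain_count r ratio d (Suc s) ?x"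
      unfolding right[symmetric] down[symmetric] using card_Un_disjoint[OF fin disj]
      by (simp add: card_image del: of_nat_Suc chain_count.simps)
    also have "\<dots> = chain_count r ratio (Suc d) s x"
      using Suc by (simp add: sum.atLeast_Suc_atMost)
    finally show ?case .
  qed
qed

text \<open>A first step down would reach a 0-vertex, after which the path could never visit the
  required other vertex. So the first step goes along the level, to position 1.\<close>

lemma admissible_paths_eq:
  assumes "i \<in> {1..n}"
  shows "admissible_paths r n m i j = (#) (i, 0) ` good_walks r n m j (i, m i)"
proof (intro equalityI subsetI)
  fix p assume p: "p \<in> admissible_paths r n m i j"
  then have "p \<noteq> []" "hd p = (i, 0)" by (auto simp: admissible_paths_def vwalk_def)
  then obtain q where q: "p = (i, 0) # q" by (cases p) auto
  have "q \<noteq> []" using p q by (auto simp: admissible_paths_def zero_vertex_def)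
  then obtain v q' where q': "q = v # q'" by (cases q) auto
  have later: "\<forall>k l. k < l \<and> l < length q \<and> zero_vertex (q ! k) \<longrightarrow> zero_vertex (q ! l)"
    using p unfolding q admissible_paths_def mem_Collect_eq all_later_positive_Cons by blast
  hence q_in: "q \<in> good_walks r n m j v"
    using p q q' by (auto simp: good_walks_def admissible_paths_def)
  have "v \<noteq> (Suc i, 0)"
  proof
    assume "v = (Suc i, 0)"
    hence "\<forall>u\<in>set p. zero_vertex u"
      using good_walks_zero_all[OF q_in] q by (auto simp: zero_vertex_def)
    thus False using p by (auto simp: admissible_paths_def)
  qed
  moreover have "((i, 0), v) \<in> parcs (lens_graph r n m)"
    using p q q' by (auto simp: admissible_paths_def)
  ultimately have "v = (i, m i)" using assms r0 by (auto simp: arc_iff)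
  thus "p \<in> (#) (i, 0) ` good_walks r n m j (i, m i)" using q q_in by blast
next
  fix p assume "p \<in> (#) (i, 0) ` good_walks r n m j (i, m i)"
  then obtain q where q: "p = (i, 0) # q" "q \<in> good_walks r n m j (i, m i)" by blast
  then obtain q' where q': "q = (i, m i) # q'" using good_walks_nonempty by blast
  have "((i, 0), (i, m i)) \<in> parcs (lens_graph r n m)"
    using assms r0 by (auto simp: arc_iff)
  moreover have "\<not> zero_vertex (i, m i)" by (simp add: zero_vertex_def)
  ultimately show "p \<in> admissible_paths r n m i j"
    unfolding q(1) admissible_paths_def mem_Collect_eq all_later_positive_Cons
    using q q' assms r0 by (auto simp: good_walks_def)
qed

lemma B_mat_entry:
  assumes "i < n" "j < n"
  shows "B_mat r n m $$ (i, j) = (if i \<le> j then chain_count r ratio (j - i) (Suc i) 1 else 0)"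
proof -
  have *: "card (admissible_paths r n m (Suc i) (Suc j)) = card (good_walks r n m (Suc j) (Suc i, m (Suc i)))"
    using assms by (subst admissible_paths_eq) (auto simp: card_image)
  show ?thesis
  proof (cases "i \<le> j")
    case True
    then show ?thesis
      using card_good_walks[where s = "Suc i" and d = "j - i" and x = 1 and n = n] assms r0 by (simp add: B_mat_def *)
  next
    case False
    then show ?thesis using assms good_walks_too_deep[of "Suc j" "Suc i"] by (simp add: B_mat_def *)
  qed
qed

end

section \<open>Similarity classes\<close>

lemma B_mat_restrict: "B_mat r n (restrict m {1..n}) = B_mat r n m"
proof -
  have "lens_graph r n (restrict m {1..n}) = lens_graph r n m"
    by (auto simp: lens_graph_def)
  thus ?thesis by (simp add: B_mat_def admissible_paths_def)
qed

lemma unit_tuples_eq: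
  assumes "r > 2"
  shows "unit_tuples r n = (\<lambda>m. restrict m {1..n}) ` {m. units_tuple r m}"
proof -
  interpret residues "int r" "residue_ring (int r)"
    using assms by unfold_locales auto
  show ?thesis
  proof (intro equalityI subsetI)
    fix m assume m: "m \<in> unit_tuples r n"
    \<comment> \<open>Outside \<open>{1..n}\<close> the tuple is continued by the unit 1.\<close>
    define m' where "m' s = (if s \<in> {1..n} then m s else 1)" for s
    have "units_tuple r m'"
      using m assms by unfold_locales (auto simp: m'_def unit_tuples_def res_units_eq PiE_iff)
    moreover have "m = restrict m' {1..n}"
      using m by (auto simp: m'_def unit_tuples_def PiE_iff extensional_def)
    ultimately show "m \<in> (\<lambda>m. restrict m {1..n}) ` {m. units_tuple r m}" by blast
  next
    fix m assume "m \<in> (\<lambda>m. restrict m {1..n}) ` {m. units_tuple r m}"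
    then obtain m' where "units_tuple r m'" "m = restrict m' {1..n}" by blast
    thus "m \<in> unit_tuples r n"
      by (auto simp: unit_tuples_def res_units_eq units_tuple_def)
  qed
qed

lemma finite_S_set:
  assumes "r > 2" shows "finite (S_set r n)"
proof -
  interpret residues "int r" "residue_ring (int r)"
    using assms by unfold_locales auto
  have "finite (Units (residue_ring (int r)))"
    by (rule finite_subset[of _ "{0..<int r}"]) (auto simp: res_units_eq)
  thus ?thesis by (auto simp: S_set_def unit_tuples_def intro!: finite_PiE)
qed

lemma S_set_eq:
  assumes "r > 2" shows "S_set r n = B_mat r n ` {m. units_tuple r m}"
  unfolding S_set_def unit_tuples_eq[OF assms] image_image B_mat_restrict ..

lemma mat_sim_refl:
  assumes "A \<in> carrier_mat n n" shows "mat_sim n A A"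
proof -
  have "1\<^sub>m n \<in> unitriangular n" by (auto simp: unitriangular_def upper_triangular_def)
  moreover have "1\<^sub>m n * (A - 1\<^sub>m n) = (A - 1\<^sub>m n) * 1\<^sub>m n" using assms by simp
  ultimately show ?thesis unfolding mat_sim_def mat_cong_def by blast
qed

text \<open>If \<open>A\<close> and \<open>B\<close> are not similar, the images of \<open>A\<close>
  and \<open>B\<close> under the relation differ, because by reflexivity \<open>B\<close> lies in
  the second but not in the first.\<close>

lemma phi_gt_1_iff:
  assumes "r > 2"
  shows "1 < phi r n \<longleftrightarrow> (\<exists>A \<in> S_set r n. \<exists>B \<in> S_set r n. \<not> mat_sim n A B)"
proof -
  let ?S = "S_set r n" and ?R = "{(A, B). A \<in> S_set r n \<and> B \<in> S_set r n \<and> mat_sim n A B}"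
  have fin: "finite (?S // ?R)" using finite_S_set[OF assms] by (intro finite_quotient) auto
  show ?thesis
  proof
    assume "1 < phi r n"
    show "\<exists>A \<in> ?S. \<exists>B \<in> ?S. \<not> mat_sim n A B"
    proof (rule ccontr)
      assume "\<not> ?thesis"
      hence "?R = ?S \<times> ?S" by auto
      hence "?S // ?R \<subseteq> {?S}" by (auto simp: quotient_def)
      hence "phi r n \<le> 1" unfolding phi_def using card_mono[of "{?S}"] by fastforce
      thus False using \<open>1 < phi r n\<close> by simp
    qed
  next
    assume "\<exists>A \<in> ?S. \<exists>B \<in> ?S. \<not> mat_sim n A B"
    then obtain A B where AB: "A \<in> ?S" "B \<in> ?S" "\<not> mat_sim n A B" by blast
    have "mat_sim n B B" using AB(2) by (intro mat_sim_refl) (auto simp: S_set_def B_mat_def)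
    hence "?R `` {A} \<noteq> ?R `` {B}" using AB by blast
    moreover have "{?R `` {A}, ?R `` {B}} \<subseteq> ?S // ?R" using AB by (auto simp: quotient_def)
    ultimately show "1 < phi r n"
      unfolding phi_def using card_mono[OF fin, of "{?R `` {A}, ?R `` {B}}"] by simp
  qed
qed

section \<open>Unitriangular equivalence of strictly upper triangular matrices\<close>

definition unitri :: "(nat \<Rightarrow> nat \<Rightarrow> int) \<Rightarrow> bool" where
  "unitri X \<longleftrightarrow> (\<forall>i. X i i = 1 \<and> (\<forall>j < i. X i j = 0))"

definition strict_upper :: "(nat \<Rightarrow> nat \<Rightarrow> int) \<Rightarrow> bool" where
  "strict_upper C \<longleftrightarrow> (\<forall>i j. j \<le> i \<longrightarrow> C i j = 0)"

text \<open>This is the equation \<open>XC = C'Y\<close> above the diagonal, with the sums cut down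
  to the indices at which unitriangular \<open>X\<close>, \<open>Y\<close> and strictly upper
  triangular \<open>C\<close>, \<open>C'\<close> can contribute. Matrices are functions on all
  naturals, so the size enters only here and passing to a leading block is immediate.\<close>

definition intertwines :: "nat \<Rightarrow> (nat \<Rightarrow> nat \<Rightarrow> int) \<Rightarrow> (nat \<Rightarrow> nat \<Rightarrow> int) \<Rightarrow>
    (nat \<Rightarrow> nat \<Rightarrow> int) \<Rightarrow> (nat \<Rightarrow> nat \<Rightarrow> int) \<Rightarrow> bool" where
  "intertwines n C C' X Y \<longleftrightarrow> (\<forall>i j. i < j \<and> j < n \<longrightarrow>
     (\<Sum>k \<in> {i..<j}. X i k * C k j) = (\<Sum>k \<in> {i<..j}. C' i k * Y k j))"

definition fun_cong :: "nat \<Rightarrow> (nat \<Rightarrow> nat \<Rightarrow> int) \<Rightarrow> (nat \<Rightarrow> nat \<Rightarrow> int) \<Rightarrow> bool" where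
  "fun_cong n C C' \<longleftrightarrow> (\<exists>X Y. unitri X \<and> unitri Y \<and> intertwines n C C' X Y)"

lemma sum_left_unitri:
  assumes "unitri X" "strict_upper C" "j < n"
  shows "(\<Sum>k = 0..<n. X i k * C k j) = (\<Sum>k \<in> {i..<j}. X i k * C k j)"
proof (rule sum.mono_neutral_right)
  show "\<forall>k \<in> {0..<n} - {i..<j}. X i k * C k j = 0"
    using assms by (auto simp: unitri_def strict_upper_def not_le not_less)
qed (use assms in auto)

lemma sum_right_unitri:
  assumes "unitri Y" "strict_upper C" "j < n"
  shows "(\<Sum>k = 0..<n. C i k * Y k j) = (\<Sum>k \<in> {i<..j}. C i k * Y k j)"
proof (rule sum.mono_neutral_right)
  show "\<forall>k \<in> {0..<n} - {i<..j}. C i k * Y k j = 0"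
    using assms by (auto simp: unitri_def strict_upper_def not_le not_less)
qed (use assms in auto)

lemma mat_cong_iff_fun_cong:
  assumes "strict_upper C" "strict_upper C'"
  shows "mat_cong n (mat n n (\<lambda>(i, j). C i j)) (mat n n (\<lambda>(i, j). C' i j)) \<longleftrightarrow> fun_cong n C C'"
proof
  assume "fun_cong n C C'"
  then obtain X Y where XY: "unitri X" "unitri Y" "intertwines n C C' X Y"
    unfolding fun_cong_def by blast
  let ?X = "mat n n (\<lambda>(i, j). X i j)" and ?Y = "mat n n (\<lambda>(i, j). Y i j)"
  have "?X * mat n n (\<lambda>(i, j). C i j) = mat n n (\<lambda>(i, j). C' i j) * ?Y"
  proof (rule eq_matI)
    fix i j assume "i < dim_row (mat n n (\<lambda>(i, j). C' i j) * ?Y)"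
      "j < dim_col (mat n n (\<lambda>(i, j). C' i j) * ?Y)"
    hence ij: "i < n" "j < n" by auto
    have "(\<Sum>k \<in> {i..<j}. X i k * C k j) = (\<Sum>k \<in> {i<..j}. C' i k * Y k j)"
      using XY(3) ij by (cases "i < j") (auto simp: intertwines_def)
    thus "(?X * mat n n (\<lambda>(i, j). C i j)) $$ (i, j) = (mat n n (\<lambda>(i, j). C' i j) * ?Y) $$ (i, j)"
      using ij sum_left_unitri[OF XY(1) assms(1) ij(2), of i] sum_right_unitri[OF XY(2) assms(2) ij(2), of i]
      by (simp add: scalar_prod_def)
  qed auto
  moreover have "?X \<in> unitriangular n" "?Y \<in> unitriangular n"
    using XY by (auto simp: unitriangular_def unitri_def upper_triangular_def)
  ultimately show "mat_cong n (mat n n (\<lambda>(i, j). C i j)) (mat n n (\<lambda>(i, j). C' i j))"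
    unfolding mat_cong_def by blast
next
  assume "mat_cong n (mat n n (\<lambda>(i, j). C i j)) (mat n n (\<lambda>(i, j). C' i j))"
  then obtain X Y where XY: "X \<in> unitriangular n" "Y \<in> unitriangular n"
    "X * mat n n (\<lambda>(i, j). C i j) = mat n n (\<lambda>(i, j). C' i j) * Y"
    unfolding mat_cong_def by blast
  \<comment> \<open>The matrices are continued by the identity outside the \<open>n\<close> by
    \<open>n\<close> block.\<close>
  define f where "f M i j = (if i < n \<and> j < n then M $$ (i, j) else if i = j then 1 else 0)"
    for M :: "int mat" and i j
  have dims: "dim_row X = n" "dim_col X = n" "dim_row Y = n" "dim_col Y = n"
    using XY by (auto simp: unitriangular_def)
  have unitri: "unitri (f X)" "unitri (f Y)"
    using XY by (auto simp: unitriangular_def unitri_def upper_triangular_def f_def)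
  have "intertwines n C C' (f X) (f Y)"
    unfolding intertwines_def
  proof (intro allI impI, elim conjE)
    fix i j assume ij: "i < j" "j < n"
    have "(\<Sum>k = 0..<n. f X i k * C k j) = (X * mat n n (\<lambda>(i, j). C i j)) $$ (i, j)"
      using ij dims by (simp add: scalar_prod_def f_def)
    also have "\<dots> = (\<Sum>k = 0..<n. C' i k * f Y k j)"
      unfolding XY(3) using ij dims by (simp add: scalar_prod_def f_def)
    finally show "(\<Sum>k \<in> {i..<j}. f X i k * C k j) = (\<Sum>k \<in> {i<..j}. C' i k * f Y k j)"
      unfolding sum_left_unitri[OF unitri(1) assms(1) ij(2)] sum_right_unitri[OF unitri(2) assms(2) ij(2)] .
  qed
  thus "fun_cong n C C'" using unitri unfolding fun_cong_def by blast
qed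

lemma fun_cong_mono: "fun_cong N C C' \<Longrightarrow> n \<le> N \<Longrightarrow> fun_cong n C C'"
  unfolding fun_cong_def intertwines_def by (meson less_le_trans)

lemma fun_cong_refl_on:
  assumes "\<And>i j. i < j \<Longrightarrow> j < n \<Longrightarrow> C i j = C' i j"
  shows "fun_cong n C C'"
proof -
  define I :: "nat \<Rightarrow> nat \<Rightarrow> int" where "I i j = (if i = j then 1 else 0)" for i j
  have "intertwines n C C' I I"
    using assms by (auto simp: intertwines_def I_def if_distrib[of "\<lambda>x. x * _"] if_distrib[of "\<lambda>x. _ * x"] cong: if_cong)
  moreover have "unitri I" by (simp add: unitri_def I_def)
  ultimately show ?thesis unfolding fun_cong_def by blast
qed

text \<open>Column \<open>n\<close> of the equation \<open>XC = C'Y\<close> involves, besides earlier choices, only column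
  \<open>n\<close> of \<open>Y\<close> and, with coefficient \<open>r\<close>, column \<open>n - 1\<close> of \<open>X\<close>.\<close>

lemma fun_cong_by_columns:
  assumes "r \<noteq> 0"
    and diag: "\<And>i. C i (Suc i) = r" "\<And>i. C' i (Suc i) = r"
    and second: "\<And>i. C i (Suc (Suc i)) = C' i (Suc (Suc i))"
    and dvd: "\<And>i j. i < j \<Longrightarrow> j < N \<Longrightarrow> k dvd C i j" "\<And>i j. i < j \<Longrightarrow> j < N \<Longrightarrow> k dvd C' i j"
    and solve: "\<And>n b. n < N \<Longrightarrow> (\<And>i. i < n \<Longrightarrow> k dvd b i) \<Longrightarrow>
      \<exists>y. \<forall>i. i + 2 < n \<longrightarrow> r dvd b i + (\<Sum>l \<in> {i<..<n}. C' i l * y l)"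
  shows "fun_cong N C C'"
proof -
  have "\<exists>X Y. unitri X \<and> unitri Y \<and> intertwines n C C' X Y" if "n \<le> N" for n
    using that
  proof (induction n)
    case 0
    have "unitri (\<lambda>i j. if i = j then 1 else 0)" by (simp add: unitri_def)
    thus ?case unfolding intertwines_def by blast
  next
    case (Suc n)
    then obtain X Y where XY: "unitri X" "unitri Y" "intertwines n C C' X Y" by auto
    show ?case
    proof (cases n)
      case 0
      then show ?thesis using XY unfolding intertwines_def by auto
    next
      case (Suc p)
      \<comment> \<open>For \<open>i < p\<close>, the number \<open>b i\<close> collects the terms
        of entry \<open>(i, n)\<close> that are already fixed; still free are column
        \<open>n\<close> of \<open>Y\<close> and column \<open>p\<close> of
        \<open>X\<close>.\<close>
      define b where "b i = C' i n - (\<Sum>l \<in> {i..<p}. X i l * C l n)" for i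
      have "k dvd b i" if "i < n" for i
        unfolding b_def using that Suc.prems \<open>n = Suc p\<close>
        by (intro dvd_diff dvd_sum dvd_mult dvd) auto
      moreover have "n < N" using Suc.prems by simp
      ultimately obtain y where
        y: "\<And>i. i + 2 < n \<Longrightarrow> r dvd b i + (\<Sum>l \<in> {i<..<n}. C' i l * y l)"
        using solve[of n b] by blast
      define R where "R i = b i + (\<Sum>l \<in> {i<..<n}. C' i l * y l)" for i
      have R: "r dvd R i" if "i < p" for i
      proof (cases "i + 2 < n")
        case True
        then show ?thesis using y by (simp add: R_def)
      next
        \<comment> \<open>In row \<open>n - 2\<close> every choice works: the second diagonals
          agree, so \<open>b i\<close> is 0, and what remains is
          \<open>r * y (Suc i)\<close>.\<close>
        case False
        hence i: "p = Suc i" "n = Suc (Suc i)" using that Suc by auto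
        have "{i<..<n} = {Suc i}" using i by auto
        thus ?thesis using XY(1) by (simp add: R_def b_def i diag second unitri_def)
      qed
      \<comment> \<open>As \<open>C p n = r\<close>, the unknown \<open>X i p\<close> enters with
        coefficient \<open>r\<close> and is found by division.\<close>
      define X' where "X' i j = (if j = p \<and> i < p then R i div r else X i j)" for i j
      define Y' where "Y' i j = (if j = n \<and> i < n then y i else Y i j)" for i j
      have "unitri X'" "unitri Y'"
        using XY by (auto simp: unitri_def X'_def Y'_def)
      moreover have "intertwines (Suc n) C C' X' Y'"
        unfolding intertwines_def
      proof (intro allI impI, elim conjE)
        fix i j assume ij: "i < j" "j < Suc n"
        show "(\<Sum>k \<in> {i..<j}. X' i k * C k j) = (\<Sum>k \<in> {i<..j}. C' i k * Y' k j)"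
        proof (cases "j = n")
          case False
          have "(\<Sum>k \<in> {i..<j}. X' i k * C k j) = (\<Sum>k \<in> {i..<j}. X i k * C k j)"
            using ij False Suc by (intro sum.cong) (auto simp: X'_def)
          also have "\<dots> = (\<Sum>k \<in> {i<..j}. C' i k * Y k j)"
            using XY(3) ij False by (auto simp: intertwines_def)
          also have "\<dots> = (\<Sum>k \<in> {i<..j}. C' i k * Y' k j)"
            using False by (intro sum.cong) (auto simp: Y'_def)
          finally show ?thesis .
        next
          case j: True
          have "{i..<n} = insert p {i..<p}" using ij j Suc by auto
          hence left: "(\<Sum>k \<in> {i..<n}. X' i k * C k n) = X' i p * r + (\<Sum>k \<in> {i..<p}. X i k * C k n)"
            using Suc diag by (simp add: X'_def)
          have "{i<..n} = insert n {i<..<n}" using ij j by auto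
          hence right: "(\<Sum>k \<in> {i<..n}. C' i k * Y' k n) = C' i n + (\<Sum>k \<in> {i<..<n}. C' i k * y k)"
            using XY(2) by (simp add: Y'_def unitri_def)
          show ?thesis
          proof (cases "i < p")
            case True
            hence "X' i p * r = R i" using R by (simp add: X'_def)
            then show ?thesis unfolding j left right by (simp add: R_def b_def)
          next
            case False
            hence "i = p" using ij j Suc by auto
            moreover have "{p<..<Suc p} = {}" by auto
            ultimately show ?thesis unfolding j left right using XY(1) Suc diag
              by (simp add: X'_def unitri_def)
          qed
        qed
      qed
      ultimately show ?thesis by blast
    qed
  qed
  thus ?thesis unfolding fun_cong_def by blast
qed

text \<open>Back substitution modulo 2: the last equation has an odd coefficient and is solved by
  \<open>b N\<close>, whose contribution is then moved into the constants of the other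
  equations.\<close>

lemma triangular_system_mod_2:
  fixes a :: "nat \<Rightarrow> nat \<Rightarrow> int"
  assumes "\<And>i. i < N \<Longrightarrow> odd (a i i)"
  shows "\<exists>z. \<forall>i < N. even (b i + (\<Sum>t \<in> {i..<N}. a i t * z t))"
  using assms
proof (induction N arbitrary: b)
  case (Suc N)
  define b' where "b' i = b i + a i N * b N" for i
  obtain z where z: "\<forall>i < N. even (b' i + (\<Sum>t \<in> {i..<N}. a i t * z t))"
    using Suc.IH Suc.prems by (metis less_SucI)
  define z' where "z' = z(N := b N)"
  have "even (b i + (\<Sum>t \<in> {i..<Suc N}. a i t * z' t))" if "i < Suc N" for i
  proof -
    have "(\<Sum>t \<in> {i..<N}. a i t * z' t) = (\<Sum>t \<in> {i..<N}. a i t * z t)"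
      by (intro sum.cong) (auto simp: z'_def)
    hence "(\<Sum>t \<in> {i..<Suc N}. a i t * z' t) = (\<Sum>t \<in> {i..<N}. a i t * z t) + a i N * b N"
      using that by (simp add: z'_def)
    hence *: "b i + (\<Sum>t \<in> {i..<Suc N}. a i t * z' t) = b' i + (\<Sum>t \<in> {i..<N}. a i t * z t)"
      by (simp add: b'_def)
    show ?thesis
    proof (cases "i = N")
      case True
      then show ?thesis unfolding * using Suc.prems[of N] by (simp add: b'_def)
    next
      case False
      then show ?thesis unfolding * using z that by simp
    qed
  qed
  thus ?case by blast
qed simp

lemma fun_cong_all_dvd:
  assumes "r \<noteq> 0" "\<And>i. C i (Suc i) = r" "\<And>i. C' i (Suc i) = r"
    and "\<And>i. C i (Suc (Suc i)) = C' i (Suc (Suc i))"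
    and "\<And>i j. i < j \<Longrightarrow> j < N \<Longrightarrow> r dvd C i j" "\<And>i j. i < j \<Longrightarrow> j < N \<Longrightarrow> r dvd C' i j"
  shows "fun_cong N C C'"
proof (rule fun_cong_by_columns[where r = r and k = r and C = C and C' = C' and N = N, OF assms])
  fix n :: nat and b :: "nat \<Rightarrow> int" assume "\<And>i. i < n \<Longrightarrow> r dvd b i"
  hence "\<forall>i. i + 2 < n \<longrightarrow> r dvd b i + (\<Sum>l \<in> {i<..<n}. C' i l * 0)" by simp
  thus "\<exists>y. \<forall>i. i + 2 < n \<longrightarrow> r dvd b i + (\<Sum>l \<in> {i<..<n}. C' i l * y l)"
    by (intro exI[of _ "\<lambda>_. 0"])
qed

text \<open>After division by \<open>k\<close>, solvability modulo \<open>2 * k\<close> becomes a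
  linear system modulo 2. The first diagonal vanishes in it, and the odd entries of the second
  diagonal are the pivots.\<close>

lemma fun_cong_half_dvd:
  assumes "k \<noteq> 0" "\<And>i. C i (Suc i) = 2 * k" "\<And>i. C' i (Suc i) = 2 * k"
    and second: "\<And>i. C i (Suc (Suc i)) = C' i (Suc (Suc i))"
    and odd_second: "\<And>i. \<not> 2 * k dvd C' i (Suc (Suc i))"
    and "\<And>i j. i < j \<Longrightarrow> j < N \<Longrightarrow> k dvd C i j" "\<And>i j. i < j \<Longrightarrow> j < N \<Longrightarrow> k dvd C' i j"
  shows "fun_cong N C C'"
proof (rule fun_cong_by_columns[where r = "2 * k" and k = k and C = C and C' = C' and N = N,
      OF _ assms(2,3) second assms(6,7)])
  fix n :: nat and b :: "nat \<Rightarrow> int" assume n: "n < N" "\<And>i. i < n \<Longrightarrow> k dvd b i"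
  define c where "c i l = C' i l div k" for i l
  have c: "C' i l = k * c i l" if "i < l" "l < N" for i l
    using assms(7)[OF that] by (simp add: c_def)
  have "odd (c i (i + 2))" if "i < n - 2" for i
    using odd_second[of i] c[of i "i + 2"] that n(1) by auto
  then obtain z where z: "\<And>i. i < n - 2 \<Longrightarrow>
      even (b i div k + (\<Sum>t \<in> {i..<n - 2}. c i (t + 2) * z t))"
    using triangular_system_mod_2[of "n - 2" "\<lambda>i t. c i (t + 2)" "\<lambda>i. b i div k"] by auto
  \<comment> \<open>Row \<open>i\<close> has its pivot in column \<open>i + 2\<close>, hence the
    shift. The truncated subtraction matters only for \<open>y 0\<close> and \<open>y 1\<close>; of
    these only \<open>y 1\<close> occurs, with coefficient \<open>2 * k\<close>.\<close>
  define y where "y l = z (l - 2)" for l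
  have "2 * k dvd b i + (\<Sum>l \<in> {i<..<n}. C' i l * y l)" if i: "i + 2 < n" for i
  proof -
    have "{i<..<n} = insert (Suc i) {i + 2..<n}" using i by auto
    hence "(\<Sum>l \<in> {i<..<n}. C' i l * y l) = 2 * k * y (Suc i) + (\<Sum>l \<in> {i + 2..<n}. C' i l * y l)"
      using assms(3) by simp
    also have "(\<Sum>l \<in> {i + 2..<n}. C' i l * y l) = (\<Sum>l \<in> {i + 2..<n - 2 + 2}. k * c i l * y l)"
      using i n(1) c by (intro sum.cong) auto
    also have "\<dots> = (\<Sum>t \<in> {i..<n - 2}. k * c i (t + 2) * y (t + 2))"
      by (rule sum.shift_bounds_nat_ivl)
    also have "\<dots> = k * (\<Sum>t \<in> {i..<n - 2}. c i (t + 2) * z t)"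
      by (simp add: y_def sum_distrib_left mult.assoc)
    finally have eq: "b i + (\<Sum>l \<in> {i<..<n}. C' i l * y l)
      = 2 * k * y (Suc i) + k * (b i div k + (\<Sum>t \<in> {i..<n - 2}. c i (t + 2) * z t))"
      using n(2)[of i] i by (simp add: algebra_simps)
    have "2 * k dvd k * (b i div k + (\<Sum>t \<in> {i..<n - 2}. c i (t + 2) * z t))"
      using z[of i] i by (auto simp: mult.commute intro!: mult_dvd_mono)
    thus ?thesis unfolding eq by (intro dvd_add dvd_triv_left)
  qed
  thus "\<exists>y. \<forall>i. i + 2 < n \<longrightarrow> 2 * k dvd b i + (\<Sum>l \<in> {i<..<n}. C' i l * y l)" by blast
qed (use assms(1) in simp)

text \<open>The corner discrepancy \<open>s * g\<close> need not be a multiple of the pivot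
  \<open>2 * s\<close>. It is removed with the help of the second diagonal, an odd multiple of
  \<open>s\<close>.\<close>

lemma fun_cong_5:
  assumes "\<And>i. C i (Suc i) = 2 * s" "\<And>i. C' i (Suc i) = 2 * s"
    and "\<And>i. C i (i + 2) = s * (2 * s + 1)" "\<And>i. C' i (i + 2) = s * (2 * s + 1)"
    and "\<And>i. C i (i + 3) = C' i (i + 3) + 2 * s * f i"
    and "C 0 4 = C' 0 4 + s * g"
  shows "fun_cong 5 C C'"
proof -
  \<comment> \<open>With \<open>X 0 2 = z\<close> still free, entries \<open>(0, 3)\<close> and
    \<open>(1, 4)\<close> are satisfied by \<open>Y 1 3 = z + f 0\<close> and
    \<open>Y 2 4 = f 1\<close>. The corner then asks for
    \<open>g + (z - f 1) * (2 * s + 1) + 2 * X 0 3 = 0\<close>, and \<open>z = f 1 + g\<close> makes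
    the first two terms add up to the even number \<open>2 * g * (s + 1)\<close>.\<close>
  define z where "z = f 1 + g"
  define X where "X i j = (if i = j then 1 else if (i, j) = (0, 2) then z
    else if (i, j) = (0, 3) then - (g * (s + 1)) else 0)" for i j :: nat
  define Y where "Y i j = (if i = j then 1 else if (i, j) = (1, 3) then z + f 0
    else if (i, j) = (2, 4) then f 1 else 0)" for i j :: nat
  have ivl:
    "{0..<1} = {0 :: nat}" "{0..<2} = {0, 1 :: nat}" "{0..<3} = {0, 1, 2 :: nat}" "{0..<4} = {0, 1, 2, 3 :: nat}"
    "{1..<2} = {1 :: nat}" "{1..<3} = {1, 2 :: nat}" "{1..<4} = {1, 2, 3 :: nat}" "{2..<3} = {2 :: nat}" "{2..<4} = {2, 3 :: nat}"
    "{3..<4} = {3 :: nat}"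
    "{0<..1} = {1 :: nat}" "{0<..2} = {1, 2 :: nat}" "{0<..3} = {1, 2, 3 :: nat}" "{0<..4} = {1, 2, 3, 4 :: nat}"
    "{1<..2} = {2 :: nat}" "{1<..3} = {2, 3 :: nat}" "{1<..4} = {2, 3, 4 :: nat}" "{2<..3} = {3 :: nat}" "{2<..4} = {3, 4 :: nat}"
    "{3<..4} = {4 :: nat}"
    by auto
  have vals: "C 0 1 = 2 * s" "C 1 2 = 2 * s" "C 2 3 = 2 * s" "C 3 4 = 2 * s"
    "C' 0 1 = 2 * s" "C' 1 2 = 2 * s" "C' 2 3 = 2 * s" "C' 3 4 = 2 * s"
    "C 0 2 = s * (2 * s + 1)" "C 1 3 = s * (2 * s + 1)" "C 2 4 = s * (2 * s + 1)"
    "C' 0 2 = s * (2 * s + 1)" "C' 1 3 = s * (2 * s + 1)" "C' 2 4 = s * (2 * s + 1)"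
    "C 0 3 = C' 0 3 + 2 * s * f 0" "C 1 4 = C' 1 4 + 2 * s * f 1" "C 0 4 = C' 0 4 + s * g"
    using assms(1)[of 0] assms(1)[of 1] assms(1)[of 2] assms(1)[of 3]
      assms(2)[of 0] assms(2)[of 1] assms(2)[of 2] assms(2)[of 3]
      assms(3)[of 0] assms(3)[of 1] assms(3)[of 2] assms(4)[of 0] assms(4)[of 1] assms(4)[of 2]
      assms(5)[of 0] assms(5)[of 1] assms(6) by (simp_all add: numeral_eq_Suc)
  have "intertwines 5 C C' X Y"
    unfolding intertwines_def
  proof (intro allI impI, elim conjE)
    fix i j :: nat assume "i < j" "j < 5"
    moreover from this have "i \<in> {0, 1, 2, 3}" "j \<in> {1, 2, 3, 4}" by auto
    ultimately consider "i = 0" "j = 1" | "i = 1" "j = 2" | "i = 2" "j = 3" | "i = 3" "j = 4"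
      | "i = 0" "j = 2" | "i = 1" "j = 3" | "i = 2" "j = 4" | "i = 0" "j = 3" | "i = 1" "j = 4"
      | "i = 0" "j = 4" by auto
    then show "(\<Sum>k \<in> {i..<j}. X i k * C k j) = (\<Sum>k \<in> {i<..j}. C' i k * Y k j)"
      by cases (simp_all add: ivl X_def Y_def vals z_def algebra_simps del: One_nat_def)
  qed
  moreover have "unitri X" "unitri Y" by (auto simp: unitri_def X_def Y_def)
  ultimately show ?thesis unfolding fun_cong_def by blast
qed

text \<open>In entry \<open>(0, n)\<close> of \<open>XC = C'Y\<close> all terms but the two corners
  contain a factor from the last column of \<open>C\<close> or the first row of \<open>C'\<close>,
  and so vanish modulo \<open>k\<close>.\<close>

lemma fun_cong_corner:
  assumes "fun_cong (Suc n) C C'" "n > 0"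
    and "\<And>i. 0 < i \<Longrightarrow> i < n \<Longrightarrow> k dvd C i n" "\<And>j. 0 < j \<Longrightarrow> j < n \<Longrightarrow> k dvd C' 0 j"
  shows "k dvd C 0 n - C' 0 n"
proof -
  obtain X Y where XY: "unitri X" "unitri Y" "intertwines (Suc n) C C' X Y"
    using assms(1) unfolding fun_cong_def by blast
  have "{0..<n} = insert 0 {0<..<n}" "{0<..n} = insert n {0<..<n}" using assms(2) by auto
  moreover have "(\<Sum>l \<in> {0..<n}. X 0 l * C l n) = (\<Sum>l \<in> {0<..n}. C' 0 l * Y l n)"
    using XY(3) assms(2) by (simp add: intertwines_def)
  ultimately have "C 0 n - C' 0 n = (\<Sum>l \<in> {0<..<n}. C' 0 l * Y l n) - (\<Sum>l \<in> {0<..<n}. X 0 l * C l n)"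
    using XY(1,2) assms(2) by (simp add: unitri_def)
  also have "k dvd \<dots>" using assms(3,4) by (intro dvd_diff dvd_sum) auto
  finally show ?thesis .
qed

text \<open>Modulo \<open>2 * q\<close> the corner equation reduces to
  \<open>C 0 5 - C' 0 5 = q * (Y 4 5 - X 0 1)\<close>, since the fourth diagonal is \<open>q\<close>
  there and the lower ones vanish. It remains to see that \<open>X 0 1\<close> and
  \<open>Y 4 5\<close> have the same parity, which the second and third diagonals of the equation
  enforce.\<close>

lemma fun_cong_corner_6:
  assumes "fun_cong 6 C C'" "q \<noteq> 0" "r \<noteq> 0" "4 * q dvd r"
    and diag: "\<And>i. C i (Suc i) = r" "\<And>i. C' i (Suc i) = r"
    and second: "\<And>i. C i (i + 2) = e" "\<And>i. C' i (i + 2) = e" "2 * q dvd e" "\<not> 4 * q dvd e"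
    and third: "\<And>i. 4 * q dvd C i (i + 3)" "\<And>i. 4 * q dvd C' i (i + 3)"
    and fourth: "2 * q dvd C 1 5 - q" "2 * q dvd C' 0 4 - q"
  shows "2 * q dvd C 0 5 - C' 0 5"
proof -
  obtain X Y where XY: "unitri X" "unitri Y" "intertwines 6 C C' X Y"
    using assms(1) unfolding fun_cong_def by blast
  have ones: "X i i = 1" "Y i i = 1" for i using XY by (auto simp: unitri_def)
  have eq: "(\<Sum>k \<in> {i..<j}. X i k * C k j) = (\<Sum>k \<in> {i<..j}. C' i k * Y k j)" if "i < j" "j < 6" for i j
    using XY(3) that by (auto simp: intertwines_def)
  have XY_eq: "X i (i + 1) = Y (i + 1) (i + 2)" if "i < 4" for i
  proof -
    have "{i..<i + 2} = {i, i + 1}" "{i<..i + 2} = {i + 1, i + 2}" by auto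
    thus ?thesis using eq[of i "i + 2"] that second(1,2)[of i] diag(1)[of "i + 1"] diag(2)[of i] \<open>r \<noteq> 0\<close>
      by (simp add: ones)
  qed
  have parity: "even (X i (i + 1) - Y (i + 2) (i + 3))" if "i < 3" for i
  proof -
    have "{i..<i + 3} = {i, i + 1, i + 2}" "{i<..i + 3} = {i + 1, i + 2, i + 3}" by auto
    hence "C i (i + 3) + X i (i + 1) * e + X i (i + 2) * r
        = r * Y (i + 1) (i + 3) + e * Y (i + 2) (i + 3) + C' i (i + 3)"
      using eq[of i "i + 3"] that second(1)[of "i + 1"] second(2)[of i] diag(1)[of "i + 2"] diag(2)[of i]
      by (simp add: ones numeral_3_eq_3)
    hence "e * (X i (i + 1) - Y (i + 2) (i + 3))
      = r * (Y (i + 1) (i + 3) - X i (i + 2)) + C' i (i + 3) - C i (i + 3)" by (simp add: algebra_simps)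
    also have "4 * q dvd \<dots>" using third assms(4) by (intro dvd_diff dvd_add dvd_mult2) auto
    finally have *: "4 * q dvd e * (X i (i + 1) - Y (i + 2) (i + 3))" .
    obtain e' where e': "e = 2 * q * e'" using second(3) by blast
    have "odd e'" using second(4) e' by auto
    have "2 * q * 2 dvd 2 * q * (e' * (X i (i + 1) - Y (i + 2) (i + 3)))"
      using * e' by (simp add: mult_ac)
    hence "2 dvd e' * (X i (i + 1) - Y (i + 2) (i + 3))" using \<open>q \<noteq> 0\<close> by (subst (asm) dvd_mult_cancel_left) auto
    thus ?thesis using \<open>odd e'\<close> by simp
  qed
  \<comment> \<open>The chain is \<open>X 0 1\<close>, \<open>Y 2 3 = X 1 2\<close>,
    \<open>Y 3 4 = X 2 3\<close>, \<open>Y 4 5\<close>, in which consecutive members agree modulo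
    2.\<close>
  have "even (X 0 1 - Y 4 5)"
    using parity[of 0] parity[of 1] parity[of 2] XY_eq[of 1] XY_eq[of 2] XY_eq[of 3]
    by (simp add: numeral_eq_Suc)
  hence "2 * q dvd q * (Y 4 5 - X 0 1)" by (auto simp: mult.commute intro!: mult_dvd_mono)
  have "{0..<5} = {0, 1, 2, 3, 4 :: nat}" "{0<..5} = {1, 2, 3, 4, 5 :: nat}" by auto
  hence "C 0 5 + X 0 1 * C 1 5 + X 0 2 * C 2 5 + X 0 3 * C 3 5 + X 0 4 * C 4 5
      = C' 0 1 * Y 1 5 + C' 0 2 * Y 2 5 + C' 0 3 * Y 3 5 + C' 0 4 * Y 4 5 + C' 0 5"
    using eq[of 0 5] by (simp add: ones)
  hence "C 0 5 - C' 0 5 = q * (Y 4 5 - X 0 1) + (C' 0 4 - q) * Y 4 5 - X 0 1 * (C 1 5 - q)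
      + C' 0 1 * Y 1 5 + C' 0 2 * Y 2 5 + C' 0 3 * Y 3 5 - X 0 2 * C 2 5 - X 0 3 * C 3 5 - X 0 4 * C 4 5"
    by (simp add: algebra_simps)
  also have "2 * q dvd \<dots>"
  proof -
    have "2 * q dvd 4 * q" by (intro mult_dvd_mono) auto
    hence r: "2 * q dvd r" using assms(4) by (rule dvd_trans)
    have third': "2 * q dvd C i (i + 3)" "2 * q dvd C' i (i + 3)" for i
      using third[of i] \<open>2 * q dvd 4 * q\<close> dvd_trans by blast+
    have "C' 0 1 = r" "C' 0 2 = e" "C 3 5 = e" "C 4 5 = r"
      using diag(1)[of 4] diag(2)[of 0] second(1)[of 3] second(2)[of 0] by (simp_all add: numeral_eq_Suc)
    moreover have "2 * q dvd C' 0 3" "2 * q dvd C 2 5"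
      using third'(2)[of 0] third'(1)[of 2] by (simp_all add: numeral_eq_Suc)
    ultimately show ?thesis
      using r second(3) fourth \<open>2 * q dvd q * (Y 4 5 - X 0 1)\<close> by (intro dvd_diff dvd_add) auto
  qed
  finally show ?thesis .
qed

section \<open>Arithmetic of the path counts\<close>

lemma degree_power_shift_diff:
  shows "\<exists>Q :: int poly. degree Q \<le> d \<and> (\<forall>x. x ^ Suc d - (x - 1) ^ Suc d = poly Q x)
    \<and> coeff Q d = int (Suc d)"
proof (induction d)
  case 0
  have "degree (1 :: int poly) \<le> 0 \<and> (\<forall>x :: int. x ^ Suc 0 - (x - 1) ^ Suc 0 = poly 1 x)
    \<and> coeff (1 :: int poly) 0 = int (Suc 0)" by simp
  thus ?case by blast
next
  case (Suc d)
  then obtain Q :: "int poly" where Q: "degree Q \<le> d"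
    "\<And>x. x ^ Suc d - (x - 1) ^ Suc d = poly Q x" "coeff Q d = int (Suc d)" by blast
  define Q' where "Q' = monom 1 (Suc d) + [:-1, 1:] * Q"
  have "degree ([:-1, 1:] * Q) \<le> Suc d"
    using degree_mult_le[of "[:-1, 1:]" Q] Q(1) by simp
  hence deg: "degree Q' \<le> Suc d"
    unfolding Q'_def by (intro degree_add_le) (simp_all add: degree_monom_eq)
  have "x ^ Suc (Suc d) - (x - 1) ^ Suc (Suc d) = poly Q' x" for x
  proof -
    have "x ^ Suc (Suc d) - (x - 1) ^ Suc (Suc d)
      = x ^ Suc d + (x - 1) * (x ^ Suc d - (x - 1) ^ Suc d)"
      by (simp add: algebra_simps)
    also have "\<dots> = poly Q' x"
      unfolding Q(2) Q'_def by (simp add: poly_monom algebra_simps)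
    finally show ?thesis .
  qed
  moreover have "coeff Q (Suc d) = 0" using Q(1) by (intro coeff_eq_0) simp
  hence "coeff Q' (Suc d) = int (Suc (Suc d))"
    using Q(3) by (simp add: Q'_def)
  ultimately show ?case using deg by blast
qed

text \<open>The factorial clears the denominators of discrete summation. The induction removes the
  top coefficient of \<open>P\<close> with the difference of a power of \<open>x\<close>.\<close>

lemma ex_antidifference:
  fixes P :: "int poly"
  assumes "degree P \<le> d"
  shows "\<exists>Q. degree Q \<le> Suc d \<and> poly Q 0 = 0 \<and>
    (\<forall>x. poly Q x - poly Q (x - 1) = fact (Suc d) * poly P x)"
  using assms
proof (induction d arbitrary: P)
  case 0
  then obtain a where P: "P = [:a:]" using degree_eq_zeroE by blast
  show ?case by (rule exI[of _ "[:0, a:]"]) (auto simp: P algebra_simps)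
next
  case (Suc d)
  obtain D :: "int poly" where D: "degree D \<le> Suc d"
    "\<And>x. x ^ Suc (Suc d) - (x - 1) ^ Suc (Suc d) = poly D x"
    "coeff D (Suc d) = int (Suc (Suc d))"
    using degree_power_shift_diff[of "Suc d"] by blast
  define a where "a = coeff P (Suc d)"
  \<comment> \<open>The coefficients of degree \<open>Suc d\<close> are \<open>a\<close> in
    \<open>P\<close> and \<open>Suc (Suc d)\<close> in \<open>D\<close>, so they cancel
    here.\<close>
  define P' where "P' = smult (int (Suc (Suc d))) P - smult a D"
  have "degree P' \<le> Suc d" unfolding P'_def
    by (intro degree_diff_le) (use Suc.prems D(1) in \<open>auto intro: order_trans[OF degree_smult_le]\<close>)
  moreover have "coeff P' (Suc d) = 0" by (simp add: P'_def a_def D(3))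
  ultimately have "degree P' \<le> d"
    by (metis Suc_leI coeff_0 degree_0 le_SucE leading_coeff_0_iff zero_le)
  from Suc.IH[OF this] obtain Q where Q: "degree Q \<le> Suc d" "poly Q 0 = 0"
    "\<And>x. poly Q x - poly Q (x - 1) = fact (Suc d) * poly P' x" by blast
  define Q' where "Q' = Q + smult (fact (Suc d) * a) (monom 1 (Suc (Suc d)))"
  have "degree Q' \<le> Suc (Suc d)" unfolding Q'_def
    using Q(1) by (intro degree_add_le) (auto intro: order_trans[OF degree_smult_le] simp: degree_monom_eq)
  moreover have "poly Q' 0 = 0" using Q(2) by (simp add: Q'_def poly_monom)
  moreover have "poly Q' x - poly Q' (x - 1) = fact (Suc (Suc d)) * poly P x" for x
  proof -
    have "poly Q' x - poly Q' (x - 1) = (poly Q x - poly Q (x - 1))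
        + fact (Suc d) * a * (x ^ Suc (Suc d) - (x - 1) ^ Suc (Suc d))"
      by (simp add: Q'_def poly_monom right_diff_distrib del: power_Suc)
    also have "\<dots> = fact (Suc d) * poly P' x + fact (Suc d) * a * poly D x"
      unfolding Q(3) D(2) ..
    also have "\<dots> = fact (Suc (Suc d)) * poly P x"
      by (simp add: P'_def algebra_simps)
    finally show ?thesis .
  qed
  ultimately show ?case by blast
qed

lemma diff_dvd_poly_diff:
  fixes P :: "int poly"
  shows "x - y dvd poly P x - poly P y"
proof (induction P)
  case (pCons a P)
  have "poly (pCons a P) x - poly (pCons a P) y = x * (poly P x - poly P y) + (x - y) * poly P y"
    by (simp add: algebra_simps)
  thus ?case using pCons by simp
qed simp

lemma sum_antidifference:
  fixes Q :: "int poly"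
  assumes "\<And>x. poly Q x - poly Q (x - 1) = c * f x" "x \<le> Suc r"
  shows "c * (\<Sum>y = x..r. f (int y)) = poly Q (int r) - poly Q (int x - 1)"
  using assms(2)
proof (induction "Suc r - x" arbitrary: x)
  case 0
  then have "x = Suc r" by simp
  then show ?case by simp
next
  case (Suc k)
  then have "c * (\<Sum>y = Suc x..r. f (int y)) = poly Q (int r) - poly Q (int (Suc x) - 1)"
    by (intro Suc.hyps) auto
  then show ?case
    using Suc(2,3) assms(1)[of "int x"] by (simp add: sum.atLeast_Suc_atMost distrib_left)
qed

text \<open>Rescaling positions is a substitution into the polynomial, and summation over the next
  position is an antidifference. The factor \<open>c\<close> collects the factorials met on the way,
  which are units modulo \<open>k\<close>.\<close>

lemma chain_count_polynomial:
  assumes "r > 0" "int k dvd int r" "coprime (int k) (fact d)"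
  shows "\<exists>c P. coprime c (int k) \<and> degree P \<le> d \<and>
    (\<forall>x \<in> {1..r}. [c * chain_count r w d s x = poly P (int x)] (mod int k)) \<and>
    (d > 0 \<longrightarrow> [poly P 1 = 0] (mod int k))"
  using assms(3)
proof (induction d arbitrary: s)
  case 0
  show ?case by (rule exI[of _ 1], rule exI[of _ 1]) auto
next
  case (Suc d)
  have cop: "coprime (int k) (fact d)" "coprime (int k) (fact (Suc d))"
    using Suc.prems by (auto simp: coprime_mult_right_iff)
  from Suc.IH[OF cop(1), of "Suc s"] obtain c P where P: "coprime c (int k)" "degree P \<le> d"
    "\<And>x. x \<in> {1..r} \<Longrightarrow> [c * chain_count r w d (Suc s) x = poly P (int x)] (mod int k)" by blast
  define P' where "P' = P \<circ>\<^sub>p [:0, w s:]"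
  have "degree P' \<le> d"
    unfolding P'_def using P(2) degree_pcompose_le[of P "[:0, w s:]"] by (auto split: if_splits)
  from ex_antidifference[OF this] obtain Q where Q: "degree Q \<le> Suc d" "poly Q 0 = 0"
    "\<And>x. poly Q x - poly Q (x - 1) = fact (Suc d) * poly P' x" by blast
  \<comment> \<open>The sum from \<open>x\<close> to \<open>r\<close> gives
    \<open>Q(r) - Q(x - 1)\<close>, and \<open>Q(r)\<close> vanishes modulo \<open>k\<close> like
    \<open>Q(0)\<close>, because \<open>k\<close> divides \<open>r\<close>. The rest is 0 at
    \<open>x = 1\<close>.\<close>
  define Q' where "Q' = - (Q \<circ>\<^sub>p [:-1, 1:])"
  have "degree Q' \<le> Suc d"
    unfolding Q'_def using Q(1) degree_pcompose_le[of Q "[:-1, 1:]"] by auto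
  moreover have "coprime (fact (Suc d) * c) (int k)"
    using P(1) cop(2) by (simp add: coprime_commute del: fact_Suc)
  moreover have "[fact (Suc d) * c * chain_count r w (Suc d) s x = poly Q' (int x)] (mod int k)"
    if x: "x \<in> {1..r}" for x
  proof -
    have "[c * chain_count r w d (Suc s) (rep r (int y * w s)) = poly P' (int y)] (mod int k)" for y
    proof -
      have "[int (rep r (int y * w s)) = int y * w s] (mod int k)"
        using rep_cong[OF assms(1)] assms(2) cong_dvd_modulus by blast
      hence "[poly P (int (rep r (int y * w s))) = poly P (int y * w s)] (mod int k)"
        by (metis cong_iff_dvd_diff dvd_trans diff_dvd_poly_diff)
      moreover have "poly P (int y * w s) = poly P' (int y)"
        by (simp add: P'_def poly_pcompose mult.commute)
      ultimately show ?thesis using P(3)[OF rep_range[OF assms(1)]] cong_trans by metis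
    qed
    hence "[c * chain_count r w (Suc d) s x = (\<Sum>y = x..r. poly P' (int y))] (mod int k)"
      by (simp add: sum_distrib_left cong_sum)
    hence "[fact (Suc d) * (c * chain_count r w (Suc d) s x)
        = fact (Suc d) * (\<Sum>y = x..r. poly P' (int y))] (mod int k)"
      by (intro cong_mult cong_refl)
    also have "fact (Suc d) * (\<Sum>y = x..r. poly P' (int y)) = poly Q (int r) - poly Q (int x - 1)"
      using x by (intro sum_antidifference Q(3)) auto
    also have "[poly Q (int r) - poly Q (int x - 1) = 0 - poly Q (int x - 1)] (mod int k)"
    proof (intro cong_diff cong_refl)
      have "int r - 0 dvd poly Q (int r) - poly Q 0" by (rule diff_dvd_poly_diff)
      thus "[poly Q (int r) = 0] (mod int k)"
        using assms(2) Q(2) by (auto simp: cong_0_iff intro: dvd_trans)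
    qed
    also have "0 - poly Q (int x - 1) = poly Q' (int x)"
      by (simp add: Q'_def poly_pcompose)
    finally show ?thesis by (simp only: mult.assoc)
  qed
  moreover have "poly Q' 1 = 0" using Q(2) by (simp add: Q'_def poly_pcompose)
  ultimately show ?case by (metis cong_refl)
qed

lemma chain_count_dvd:
  assumes "r > 0" "int k dvd int r" "coprime (int k) (fact d)" "d > 0"
  shows "int k dvd chain_count r w d s 1"
proof -
  obtain c P where "coprime c (int k)" "[c * chain_count r w d s 1 = poly P 1] (mod int k)"
    "[poly P 1 = 0] (mod int k)"
    using chain_count_polynomial[OF assms(1-3), of w s] assms(1,4) by force
  thus ?thesis
    by (metis cong_0_iff cong_dvd_iff coprime_commute coprime_dvd_mult_right_iff)
qed

section \<open>Closed forms for the second, third and fourth diagonals\<close>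

lemma rep_bij:
  assumes "r > 0" "coprime a (int r)"
  shows "bij_betw (\<lambda>y. rep r (int y * a)) {1..r} {1..r}"
proof -
  have "inj_on (\<lambda>y. rep r (int y * a)) {1..r}"
  proof (rule inj_onI)
    fix x y assume xy: "x \<in> {1..r}" "y \<in> {1..r}" "rep r (int x * a) = rep r (int y * a)"
    hence "[int x * a = int y * a] (mod int r)"
      using rep_cong[OF assms(1)] by (metis cong_sym cong_trans)
    hence "[int x = int y] (mod int r)" using assms(2) cong_mult_rcancel by blast
    thus "x = y" using rep_eqI[OF assms(1) xy(1), of "int y"] rep_id[OF assms(1) xy(2)] by simp
  qed
  moreover have "(\<lambda>y. rep r (int y * a)) ` {1..r} \<subseteq> {1..r}" using rep_range[OF assms(1)] by blast
  ultimately show ?thesis by (simp add: bij_betw_def endo_inj_surj)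
qed

lemma sum_rep:
  assumes "r > 0" "coprime a (int r)"
  shows "(\<Sum>y = 1..r. f (rep r (int y * a))) = (\<Sum>y = 1..r. f y)"
  using sum.reindex_bij_betw[OF rep_bij[OF assms]] .

lemma sum_tail_swap:
  fixes f g :: "nat \<Rightarrow> int"
  shows "(\<Sum>x = 1..r. f x * (\<Sum>y = x..r. g y)) = (\<Sum>y = 1..r. (\<Sum>x = 1..y. f x) * g y)"
  by (induction r) (simp_all add: sum.distrib algebra_simps sum_distrib_left)

text \<open>From position 1 the walk may leave at any position, and multiplication by the unit
  \<open>w s\<close> permutes these, so the first ratio drops out.\<close>

lemma chain_count_from_1:
  assumes "r > 0" "coprime (w s) (int r)"
  shows "chain_count r w (Suc d) s 1 = (\<Sum>y = 1..r. chain_count r w d (Suc s) y)"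
  using sum_rep[OF assms] by simp

text \<open>The weight \<open>y\<close> counts the positions at which a walk leaving the next level
  at \<open>y\<close> can have entered it.\<close>

lemma chain_count_from_1':
  assumes "r > 0" "coprime (w s) (int r)"
  shows "chain_count r w (Suc (Suc d)) s 1
    = (\<Sum>y = 1..r. int y * chain_count r w d (Suc (Suc s)) (rep r (int y * w (Suc s))))"
  unfolding chain_count_from_1[where w = w and s = s, OF assms]
  using sum_tail_swap[of "\<lambda>_. 1" "\<lambda>y. chain_count r w d (Suc (Suc s)) (rep r (int y * w (Suc s)))" r] by simp

lemma chain_count_1: "x \<le> r \<Longrightarrow> chain_count r w 1 s x = int r + 1 - int x"
  by simp

lemma gauss_sum_int: "2 * (\<Sum>y = 1..r. int y) = int r * (int r + 1)"
  by (induction r) (simp_all add: algebra_simps)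

lemma square_sum_int: "6 * (\<Sum>y = 1..r. int y * int y) = int r * (int r + 1) * (2 * int r + 1)"
  by (induction r) (simp_all add: algebra_simps)

lemma chain_count_2:
  assumes "r > 0" "coprime (w s) (int r)"
  shows "2 * chain_count r w 2 s 1 = int r * (int r + 1)"
proof -
  have "chain_count r w 2 s 1 = (\<Sum>y = 1..r. int y)"
    using chain_count_from_1'[where w = w and s = s and d = 0, OF assms] by (simp add: numeral_2_eq_2)
  thus ?thesis using gauss_sum_int by simp
qed

lemma cong_obtain:
  fixes a b k :: int
  assumes "[a = b] (mod k)" obtains q where "a = b + k * q"
  using assms by (metis cong_iff_lin cong_sym)

lemma sum_mult_affine:
  fixes f :: "nat \<Rightarrow> int"
  shows "(\<Sum>y \<in> S. f y * c * (1 - int y * a)) = c * (\<Sum>y \<in> S. f y) - c * a * (\<Sum>y \<in> S. f y * int y)"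
proof -
  have "f y * c * (1 - int y * a) = c * f y - c * a * (f y * int y)" for y
    by (simp add: algebra_simps)
  thus ?thesis by (simp add: sum_subtractf sum_distrib_left)
qed

lemma chain_count_3_cong:
  assumes "r > 0" "coprime (w s) (int r)"
  shows "[chain_count r w 3 s 1 = (\<Sum>y = 1..r. int y * (1 - int y * w (Suc s)))] (mod int r)"
proof -
  have "chain_count r w 3 s 1 = (\<Sum>y = 1..r. int y * chain_count r w 1 (s + 2) (rep r (int y * w (Suc s))))"
    using chain_count_from_1'[where w = w and s = s and d = 1, OF assms] by (simp add: numeral_3_eq_3 eval_nat_numeral)
  also have "[\<dots> = (\<Sum>y = 1..r. int y * (1 - int y * w (Suc s)))] (mod int r)"
  proof (intro cong_sum cong_mult cong_refl)
    fix y
    have "rep r (int y * w (Suc s)) \<le> r" using rep_range[OF assms(1)] by auto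
    hence "chain_count r w 1 (s + 2) (rep r (int y * w (Suc s))) = int r + 1 - int (rep r (int y * w (Suc s)))"
      by (rule chain_count_1)
    also have "[\<dots> = 0 + 1 - int y * w (Suc s)] (mod int r)"
      by (intro cong_diff cong_add cong_refl rep_cong assms(1)) (simp add: cong_def)
    finally show "[chain_count r w 1 (s + 2) (rep r (int y * w (Suc s))) = 1 - int y * w (Suc s)] (mod int r)"
      by simp
  qed
  finally show ?thesis .
qed

text \<open>The formula is kept as an equation scaled by 6, with an unspecified multiple of
  \<open>6 * r\<close>, because dividing a congruence modulo an even \<open>r\<close> by 2 would
  lose a power of two.\<close>

lemma chain_count_3_eq:
  assumes "r > 0" "coprime (w s) (int r)"
  shows "\<exists>q. 6 * chain_count r w 3 s 1 = 3 * (int r * (int r + 1))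
    - w (Suc s) * (int r * (int r + 1) * (2 * int r + 1)) + 6 * int r * q"
proof -
  have "(\<Sum>y = 1..r. int y * (1 - int y * w (Suc s)))
    = (\<Sum>y = 1..r. int y) - w (Suc s) * (\<Sum>y = 1..r. int y * int y)"
    using sum_mult_affine[of int 1] by simp
  with chain_count_3_cong[of r w s] assms obtain q where "chain_count r w 3 s 1 = (\<Sum>y = 1..r. int y) - w (Suc s) * (\<Sum>y = 1..r. int y * int y) + int r * q"
    by (metis cong_obtain)
  hence "6 * chain_count r w 3 s 1 = 3 * (2 * (\<Sum>y = 1..r. int y)) - w (Suc s) * (6 * (\<Sum>y = 1..r. int y * int y)) + 6 * int r * q"
    by (simp add: algebra_simps)
  thus ?thesis unfolding gauss_sum_int square_sum_int by blast
qed

lemma tetra_sum: "6 * (\<Sum>y = 1..r. (\<Sum>x = 1..y. int x)) = int r * (int r + 1) * (int r + 2)"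
proof (induction r)
  case (Suc r)
  show ?case using Suc gauss_sum_int[of "Suc r"] by (simp add: algebra_simps)
qed simp

lemma weighted_tetra_sum:
  "24 * (\<Sum>y = 1..r. (\<Sum>x = 1..y. int x) * int y) = int r * (int r + 1) * (int r + 2) * (3 * int r + 1)"
proof (induction r)
  case (Suc r)
  have "2 * ((\<Sum>x = 1..Suc r. int x) * int (Suc r)) = int (Suc r) * (int (Suc r) + 1) * int (Suc r)"
    using gauss_sum_int[of "Suc r"] by (metis mult.assoc)
  thus ?case using Suc by (simp add: algebra_simps)
qed simp

text \<open>Reindexing by the inverse \<open>v\<close> of \<open>w (s + 1)\<close> moves the
  multiplier from the tail to the weight. Exchanging the sums then turns the weight into
  \<open>v\<close> times a triangular number modulo \<open>r\<close>, against the linear tail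
  \<open>1 - y * w (s + 2)\<close>.\<close>

lemma chain_count_4_eq:
  assumes "r > 0" "\<And>s. coprime (w s) (int r)"
  shows "\<exists>v q. coprime v (int r) \<and> 24 * chain_count r w 4 s 1 = v * (int r * (int r + 1) * (int r + 2)) *
    (4 - w (s + 2) * (3 * int r + 1)) + 24 * int r * q"
proof -
  let ?w = "w (s + 2)"
  obtain v where v: "[w (s + 1) * v = 1] (mod int r)"
    using cong_solve_coprime_int assms(2) by blast
  hence cop: "coprime v (int r)" by (metis coprime_mult_left_iff coprime_1_left cong_imp_coprime cong_sym)
  have "chain_count r w 4 s 1 = (\<Sum>y = 1..r. int y * chain_count r w 2 (s + 2) (rep r (int y * w (s + 1))))"
    using chain_count_from_1'[of r w s 2] assms by (simp add: eval_nat_numeral)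
  also have "\<dots> = (\<Sum>z = 1..r. int (rep r (int z * v)) * chain_count r w 2 (s + 2) z)"
  proof -
    have "rep r (int (rep r (int y * v)) * w (s + 1)) = y" if "y \<in> {1..r}" for y
    proof (rule rep_eqI[OF assms(1) that])
      have "[int (rep r (int y * v)) * w (s + 1) = (int y * v) * w (s + 1)] (mod int r)"
        by (intro cong_mult cong_refl rep_cong assms(1))
      also have "(int y * v) * w (s + 1) = int y * (w (s + 1) * v)" by simp
      also have "[\<dots> = int y * 1] (mod int r)" by (intro cong_mult cong_refl v)
      finally show "[int y = int (rep r (int y * v)) * w (s + 1)] (mod int r)"
        by (simp add: cong_sym)
    qed
    thus ?thesis
      by (subst sum_rep[OF assms(1) cop, symmetric]) (auto intro!: sum.cong)
  qed
  also have "\<dots> = (\<Sum>y = 1..r. (\<Sum>x = 1..y. int (rep r (int x * v))) * chain_count r w 1 (s + 3) (rep r (int y * ?w)))"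
    using sum_tail_swap[of "\<lambda>z. int (rep r (int z * v))" "\<lambda>y. chain_count r w 1 (s + 3) (rep r (int y * ?w))" r]
    by (simp add: eval_nat_numeral)
  finally have eq: "chain_count r w 4 s 1 = (\<Sum>y = 1..r. (\<Sum>x = 1..y. int (rep r (int x * v))) *
    chain_count r w 1 (s + 3) (rep r (int y * ?w)))" .
  have "[chain_count r w 4 s 1 = (\<Sum>y = 1..r. (\<Sum>x = 1..y. int x * v) * (1 - int y * ?w))] (mod int r)"
    unfolding eq
  proof (intro cong_sum cong_mult rep_cong assms(1))
    fix y
    have "rep r (int y * ?w) \<le> r" using rep_range[OF assms(1)] by auto
    hence "chain_count r w 1 (s + 3) (rep r (int y * ?w)) = int r + 1 - int (rep r (int y * ?w))"
      by (rule chain_count_1)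
    also have "[\<dots> = 0 + 1 - int y * ?w] (mod int r)"
      by (intro cong_diff cong_add cong_refl rep_cong assms(1)) (simp add: cong_def)
    finally show "[chain_count r w 1 (s + 3) (rep r (int y * ?w)) = 1 - int y * ?w] (mod int r)"
      by simp
  qed
  hence "[chain_count r w 4 s 1 = v * (\<Sum>y = 1..r. (\<Sum>x = 1..y. int x))
    - v * ?w * (\<Sum>y = 1..r. (\<Sum>x = 1..y. int x) * int y)] (mod int r)"
    unfolding sum_distrib_right[symmetric] sum_mult_affine .
  then obtain q where q: "chain_count r w 4 s 1 = v * (\<Sum>y = 1..r. (\<Sum>x = 1..y. int x))
    - v * ?w * (\<Sum>y = 1..r. (\<Sum>x = 1..y. int x) * int y) + int r * q"
    by (rule cong_obtain)
  have "24 * (v * A - v * ?w * B + int r * q) = 4 * v * (6 * A) - v * ?w * (24 * B) + 24 * int r * q"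
    for A B by (simp add: algebra_simps)
  hence "24 * chain_count r w 4 s 1 = 4 * v * (int r * (int r + 1) * (int r + 2))
    - v * ?w * (int r * (int r + 1) * (int r + 2) * (3 * int r + 1)) + 24 * int r * q"
    by (simp only: q tetra_sum weighted_tetra_sum)
  hence "24 * chain_count r w 4 s 1 = v * (int r * (int r + 1) * (int r + 2)) *
    (4 - ?w * (3 * int r + 1)) + 24 * int r * q"
    by (simp add: algebra_simps)
  thus ?thesis using cop by blast
qed

section \<open>Sizes with one class and sizes with several\<close>

text \<open>This is \<open>B - I\<close>, for arbitrary ratios \<open>w\<close>. The level is
  \<open>Suc i\<close> because levels count from 1 and matrix indices from 0.\<close>

definition path_matrix :: "nat \<Rightarrow> (nat \<Rightarrow> int) \<Rightarrow> nat \<Rightarrow> nat \<Rightarrow> int" where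
  "path_matrix r w i j = (if i < j then chain_count r w (j - i) (Suc i) 1 else 0)"

lemma strict_upper_path_matrix: "strict_upper (path_matrix r w)"
  by (simp add: strict_upper_def path_matrix_def)

lemma path_matrix_add: "d > 0 \<Longrightarrow> path_matrix r w i (i + d) = chain_count r w d (Suc i) 1"
  by (simp add: path_matrix_def)

lemma path_matrix_1: "path_matrix r w i (Suc i) = int r"
  using path_matrix_add[of 1 r w i] by simp

lemma path_matrix_2:
  assumes "r > 0" "\<And>s. coprime (w s) (int r)"
  shows "2 * path_matrix r w i (i + 2) = int r * (int r + 1)"
proof -
  have "path_matrix r w i (i + 2) = chain_count r w 2 (Suc i) 1" by (rule path_matrix_add) simp
  thus ?thesis using chain_count_2[of r w "Suc i"] assms by simp
qed

lemma (in units_tuple) B_mat_minus_one: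
  "B_mat r n m - 1\<^sub>m n = mat n n (\<lambda>(i, j). path_matrix r ratio i j)"
proof (rule eq_matI)
  fix i j assume "i < dim_row (mat n n (\<lambda>(i, j). path_matrix r ratio i j))"
    "j < dim_col (mat n n (\<lambda>(i, j). path_matrix r ratio i j))"
  hence ij: "i < n" "j < n" by auto
  have "(B_mat r n m - 1\<^sub>m n) $$ (i, j) = B_mat r n m $$ (i, j) - 1\<^sub>m n $$ (i, j)"
    using ij by (intro index_minus_mat) auto
  thus "(B_mat r n m - 1\<^sub>m n) $$ (i, j) = mat n n (\<lambda>(i, j). path_matrix r ratio i j) $$ (i, j)"
    using ij by (cases i j rule: linorder_cases) (simp_all add: B_mat_entry path_matrix_def)
qed (auto simp: B_mat_def)

lemma mat_sim_B_mat_iff: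
  assumes "units_tuple r m" "units_tuple r m'"
  shows "mat_sim n (B_mat r n m) (B_mat r n m') \<longleftrightarrow>
    fun_cong n (path_matrix r (units_tuple.ratio r m)) (path_matrix r (units_tuple.ratio r m'))"
  unfolding mat_sim_def units_tuple.B_mat_minus_one[OF assms(1)] units_tuple.B_mat_minus_one[OF assms(2)]
  by (intro mat_cong_iff_fun_cong strict_upper_path_matrix)

section \<open>Sizes with a single class\<close>

lemma coprime_fact_if_large_prime_factors:
  assumes "\<And>q :: nat. prime q \<Longrightarrow> q dvd k \<Longrightarrow> d < q"
  shows "coprime (int k) (fact d)"
proof -
  have "coprime k (fact d)"
  proof (rule ccontr)
    assume "\<not> coprime k (fact d)"
    then obtain c where c: "c dvd k" "c dvd fact d" "\<not> is_unit c" by (rule not_coprimeE)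
    hence "c \<noteq> 1" by auto
    then obtain q where q: "prime q" "q dvd c" using prime_factor_nat by blast
    have "d < q" using assms q(1) dvd_trans[OF q(2) c(1)] .
    moreover have "q \<le> d" using prime_dvd_fact_iff[OF q(1)] dvd_trans[OF q(2) c(2)] by blast
    ultimately show False by simp
  qed
  thus ?thesis by (metis coprime_int_iff of_nat_fact)
qed

lemma path_matrix_dvd:
  assumes "r > 0" "k dvd r" "\<And>q :: nat. prime q \<Longrightarrow> q dvd k \<Longrightarrow> p \<le> q" "i < j" "j - i < p"
  shows "int k dvd path_matrix r w i j"
proof -
  have "coprime (int k) (fact (j - i))"
    using assms(3,5) by (intro coprime_fact_if_large_prime_factors) (meson less_le_trans)
  thus ?thesis using chain_count_dvd[of r k "j - i" w "Suc i"] assms by (simp add: path_matrix_def)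
qed

text \<open>For \<open>r = k\<close> every entry is a multiple of \<open>r\<close>. For
  \<open>r = 2 * k\<close> the second diagonal is \<open>k * (2 * k + 1)\<close>, an odd multiple of
  \<open>k\<close>, and serves as pivot.\<close>

lemma fun_cong_if_not_4_dvd:
  assumes "r > 0" "\<And>s. coprime (w s) (int r)" "\<And>s. coprime (w' s) (int r)"
    and "r = k \<or> r = 2 * k" "odd k" "\<And>q :: nat. prime q \<Longrightarrow> q dvd k \<Longrightarrow> p \<le> q" "n \<le> p"
  shows "fun_cong n (path_matrix r w) (path_matrix r w')"
proof -
  have "k dvd r" using assms(4) by auto
  have dvd: "int k dvd path_matrix r v i j" if "i < j" "j < n" for v i j
    using path_matrix_dvd[OF assms(1) \<open>k dvd r\<close> assms(6)] that assms(7) by simp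
  have second: "2 * path_matrix r w i (Suc (Suc i)) = int r * (int r + 1)"
    "2 * path_matrix r w' i (Suc (Suc i)) = int r * (int r + 1)" for i
    using path_matrix_2[of r w i] path_matrix_2[of r w' i] assms(1-3) by simp_all
  hence second': "path_matrix r w i (Suc (Suc i)) = path_matrix r w' i (Suc (Suc i))" for i
    by (metis mult_cancel_left zero_neq_numeral)
  from assms(4) show ?thesis
  proof
    assume "r = k"
    thus ?thesis
      using assms(1) dvd second' path_matrix_1 by (intro fun_cong_all_dvd[where r = "int r"]) auto
  next
    assume r: "r = 2 * k"
    have "\<not> 2 * int k dvd path_matrix r w' i (Suc (Suc i))" for i
    proof
      assume "2 * int k dvd path_matrix r w' i (Suc (Suc i))"
      then obtain t where "path_matrix r w' i (Suc (Suc i)) = 2 * int k * t" by blast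
      hence "2 * int k * (2 * t) = 2 * int k * (2 * int k + 1)"
        using second(2)[of i] r by (simp add: algebra_simps)
      hence "2 * t = 2 * int k + 1" using assms(1) r by simp
      thus False by presburger
    qed
    thus ?thesis
      using assms(1) dvd second' path_matrix_1[of r] r
      by (intro fun_cong_half_dvd[where k = "int k"]) auto
  qed
qed

lemma dvd_of_odd_multiple:
  fixes c q :: int
  assumes "2 ^ a dvd b * c" "odd b" shows "2 ^ a dvd c"
proof -
  have "coprime (2 ^ a) b" using assms(2) by simp
  thus ?thesis using assms(1) coprime_dvd_mult_right_iff by blast
qed

text \<open>Since \<open>r\<close> is even, the unit \<open>w\<close> is odd and
  \<open>3 - w * (2 * r + 1)\<close> is even. This cancels the 2 of the scaling factor 6, and the
  remaining 3 is odd.\<close>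

lemma path_matrix_3_dvd:
  assumes "r = 2 ^ v * k" "v \<ge> 1" "k > 0" "\<And>s. coprime (w s) (int r)"
  shows "2 ^ v dvd path_matrix r w i (i + 3)"
proof -
  have "r > 0" using assms by simp
  obtain q where q: "6 * path_matrix r w i (i + 3) = 3 * (int r * (int r + 1))
    - w (Suc (Suc i)) * (int r * (int r + 1) * (2 * int r + 1)) + 6 * int r * q"
    using chain_count_3_eq[OF \<open>r > 0\<close>, of w "Suc i"] assms(4) by (auto simp: path_matrix_add)
  have "even (int r)" using assms(1,2) by simp
  hence "odd (w (Suc (Suc i)))" using assms(4) by (metis coprime_common_divisor odd_one)
  hence "even (3 - w (Suc (Suc i)) * (2 * int r + 1))" by simp
  then obtain t where t: "3 - w (Suc (Suc i)) * (2 * int r + 1) = 2 * t" by (rule evenE)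
  have "6 * path_matrix r w i (i + 3)
    = int r * (int r + 1) * (3 - w (Suc (Suc i)) * (2 * int r + 1)) + 6 * int r * q"
    unfolding q by (simp add: algebra_simps)
  hence "3 * path_matrix r w i (i + 3) = int r * ((int r + 1) * t + 3 * q)"
    unfolding t by (simp add: algebra_simps)
  moreover have "2 ^ v dvd int r" using assms(1) by simp
  ultimately have "2 ^ v dvd 3 * path_matrix r w i (i + 3)" by simp
  thus ?thesis by (rule dvd_of_odd_multiple) simp
qed

text \<open>As 4 divides \<open>r\<close>, the factor \<open>r + 2\<close> is twice an odd number.
  The closed form then says that 3 times the entry is \<open>2 ^ u * k * U\<close> with
  \<open>U\<close> odd, so the entry is an odd multiple of \<open>2 ^ u\<close>.\<close>

lemma path_matrix_4_cong:
  assumes "r = 4 * 2 ^ u * k" "odd k" "\<And>s. coprime (w s) (int r)"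
  shows "2 * 2 ^ u dvd path_matrix r w i (i + 4) - 2 ^ u"
proof -
  let ?c = "path_matrix r w i (i + 4)" and ?w = "w (i + 3)" and ?q = "2 ^ u :: int"
  have "k > 0" using assms(2) by (cases k) auto
  hence "r > 0" using assms(1) by simp
  have pm: "?c = chain_count r w 4 (Suc i) 1" by (rule path_matrix_add) simp
  have idx: "Suc i + 2 = i + 3" by simp
  obtain v y where vy: "coprime v (int r)" "24 * ?c = v * (int r * (int r + 1) * (int r + 2)) *
    (4 - ?w * (3 * int r + 1)) + 24 * int r * y"
    unfolding pm
    using chain_count_4_eq[where r = r and w = w and s = "Suc i", OF \<open>r > 0\<close> assms(3), unfolded idx] by blast
  have r: "int r = 4 * ?q * int k" using assms(1) by simp
  have "even (int r)" unfolding r by simp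
  hence odd: "odd ?w" "odd v" using assms(3) vy(1) by (metis coprime_common_divisor odd_one)+
  define U where "U = v * (int r + 1) * (2 * ?q * int k + 1) * (4 - ?w * (3 * int r + 1)) + 12 * y"
  have "odd U" unfolding U_def using odd \<open>even (int r)\<close> by simp
  have "int r + 2 = 2 * (2 * ?q * int k + 1)" unfolding r by (simp add: algebra_simps)
  hence "24 * ?c = 2 * int r * U"
    unfolding vy(2) U_def by (simp add: algebra_simps)
  hence c: "3 * ?c = ?q * (int k * U)" unfolding r by simp
  have "?q dvd 3 * ?c" unfolding c by (rule dvd_triv_left)
  hence "?q dvd ?c" by (rule dvd_of_odd_multiple) simp
  then obtain c' where c': "?c = ?q * c'" by blast
  hence "?q * (3 * c') = ?q * (int k * U)" using c by (simp add: algebra_simps)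
  hence "3 * c' = int k * U" by simp
  hence "odd c'" using \<open>odd U\<close> assms(2) by (metis even_mult_iff even_of_nat_iff)
  then obtain t where "c' = 2 * t + 1" by (rule oddE)
  hence "?c - ?q = 2 * ?q * t" unfolding c' by (simp add: algebra_simps)
  thus ?thesis by simp
qed

text \<open>With \<open>s = r / 2\<close>, the differences on the third diagonal are multiples of
  \<open>2 * s\<close> and the one in the corner is a multiple of \<open>s\<close>. Both facts are
  glued from the 2-part of \<open>r\<close> and from \<open>k\<close>, which divides the first four
  diagonals as its prime factors are at least 5.\<close>

lemma fun_cong_if_4_dvd:
  assumes "r = 4 * 2 ^ u * k" "odd k"
    and w: "\<And>s. coprime (w s) (int r)" "\<And>s. coprime (w' s) (int r)"
    and "\<And>q :: nat. prime q \<Longrightarrow> q dvd k \<Longrightarrow> 5 \<le> q" "n \<le> 5"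
  shows "fun_cong n (path_matrix r w) (path_matrix r w')"
proof -
  let ?C = "path_matrix r w" and ?C' = "path_matrix r w'"
  have "k > 0" using assms(2) by (cases k) auto
  hence "r > 0" using assms(1) by simp
  have "k dvd r" using assms(1) by simp
  define s :: int where "s = 2 * 2 ^ u * int k"
  have r: "int r = 2 * s" "r = 2 ^ (u + 2) * k" using assms(1) by (simp_all add: s_def)
  have dvd: "int k dvd path_matrix r v i j" if "i < j" "j - i < 5" for v i j
    using path_matrix_dvd[OF \<open>r > 0\<close> \<open>k dvd r\<close> assms(5)] that by blast
  have third: "2 * s dvd ?C i (i + 3) - ?C' i (i + 3)" for i
  proof -
    have "2 ^ (u + 2) dvd ?C i (i + 3) - ?C' i (i + 3)"
      using path_matrix_3_dvd[OF r(2) _ \<open>k > 0\<close>] w by (intro dvd_diff) auto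
    moreover have "int k dvd ?C i (i + 3) - ?C' i (i + 3)" by (intro dvd_diff dvd) auto
    moreover have "coprime (2 ^ (u + 2)) (int k)"
      using assms(2) by (simp only: coprime_power_left_iff) simp
    ultimately have "2 ^ (u + 2) * int k dvd ?C i (i + 3) - ?C' i (i + 3)" by (intro divides_mult)
    thus ?thesis by (simp add: s_def mult_ac)
  qed
  have "s dvd ?C 0 4 - ?C' 0 4"
  proof -
    have "2 * 2 ^ u dvd (?C 0 (0 + 4) - 2 ^ u) - (?C' 0 (0 + 4) - 2 ^ u)"
      by (rule dvd_diff; rule path_matrix_4_cong[OF assms(1,2)]) (rule w)+
    hence "2 ^ (u + 1) dvd ?C 0 4 - ?C' 0 4" by simp
    moreover have "int k dvd ?C 0 4 - ?C' 0 4" by (intro dvd_diff dvd) auto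
    moreover have "coprime (2 ^ (u + 1)) (int k)" using assms(2) by simp
    ultimately have "2 ^ (u + 1) * int k dvd ?C 0 4 - ?C' 0 4" by (intro divides_mult)
    thus ?thesis by (simp add: s_def)
  qed
  then obtain g where g: "?C 0 4 = ?C' 0 4 + s * g" by (metis add.commute diff_add_cancel dvdE)
  have "\<forall>i. \<exists>f. ?C i (i + 3) = ?C' i (i + 3) + 2 * s * f"
    using third by (metis add.commute diff_add_cancel dvdE)
  then obtain f where f: "\<And>i. ?C i (i + 3) = ?C' i (i + 3) + 2 * s * f i" by metis
  have "path_matrix r v i (i + 2) = s * (2 * s + 1)" if "\<And>s. coprime (v s) (int r)" for v i
    using path_matrix_2[of r v i] \<open>r > 0\<close> that by (simp add: r(1))
  hence "fun_cong 5 ?C ?C'"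
    using f g w path_matrix_1[of r] r(1) by (intro fun_cong_5) auto
  thus ?thesis using assms(6) by (rule fun_cong_mono)
qed

lemma fun_cong_if_le_3:
  assumes "r > 0" "\<And>s. coprime (w s) (int r)" "\<And>s. coprime (w' s) (int r)" "n \<le> 3"
  shows "fun_cong n (path_matrix r w) (path_matrix r w')"
proof (rule fun_cong_refl_on)
  fix i j assume ij: "i < j" "j < n"
  hence "j = Suc i \<or> j = i + 2" using assms(4) by auto
  thus "path_matrix r w i j = path_matrix r w' i j"
    using path_matrix_2[of r w i] path_matrix_2[of r w' i] assms(1-3) path_matrix_1 by auto
qed

section \<open>Sign tuples and sizes with several classes\<close>

lemma rep_congI: "[a = b] (mod int r) \<Longrightarrow> rep r a = rep r b"
  by (simp add: rep_def cong_def) (metis mod_diff_left_eq)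

lemma chain_count_cong:
  assumes "\<And>s'. s \<le> s' \<Longrightarrow> [w s' = w' s'] (mod int r)"
  shows "chain_count r w d s x = chain_count r w' d s x"
  using assms
proof (induction d arbitrary: s x)
  case (Suc d)
  have "rep r (int y * w s) = rep r (int y * w' s)" for y
    using Suc.prems[of s] by (intro rep_congI cong_mult cong_refl) auto
  moreover have "chain_count r w d (Suc s) x = chain_count r w' d (Suc s) x" for x
    using Suc by auto
  ultimately show ?case by simp
qed simp

text \<open>Without rescaling the walks are the weakly increasing sequences of \<open>d\<close>
  positions in \<open>{x..r}\<close>; the inner induction is the hockey-stick identity.\<close>

lemma chain_count_ones:
  assumes "\<And>s'. s \<le> s' \<Longrightarrow> w s' = 1" "x \<in> {1..r}"
  shows "chain_count r w d s x = int ((r - x + d) choose d)"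
  using assms
proof (induction d arbitrary: s x)
  case (Suc d)
  have "(\<Sum>y = x..r. int ((r - y + d) choose d)) = int ((r - x + Suc d) choose Suc d)"
    using Suc.prems(2)
  proof (induction "r - x" arbitrary: x)
    case (Suc k)
    have "r - x = Suc (r - Suc x)" "r + d - x = Suc (r + d - Suc x)" using Suc by auto
    thus ?case using Suc(1)[of "Suc x"] Suc by (simp add: sum.atLeast_Suc_atMost)
  qed simp
  moreover have "chain_count r w d (Suc s) (rep r (int y * w s)) = int ((r - y + d) choose d)"
    if "y \<in> {x..r}" for y
  proof -
    have "y \<in> {1..r}" "rep r (int y * w s) = y"
      using Suc.prems that rep_id[of r y] by auto
    thus ?thesis using Suc.IH[of "Suc s" y] Suc.prems(1) by auto
  qed
  ultimately show ?case by simp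
qed simp

definition sign_tuple :: "nat \<Rightarrow> nat set \<Rightarrow> nat \<Rightarrow> int" where
  "sign_tuple r S s = (if s \<in> S then int r - 1 else 1)"

text \<open>The ratios may be taken as integer signs instead of residues, because chain counts
  depend on them only modulo \<open>r\<close>.\<close>

definition sign_ratio :: "nat set \<Rightarrow> nat \<Rightarrow> int" where
  "sign_ratio S s = (if s \<in> S \<longleftrightarrow> Suc s \<in> S then 1 else - 1)"

lemma units_tuple_sign:
  assumes "r > 2" shows "units_tuple r (sign_tuple r S)"
proof
  have "coprime (int r - 1) (int r)" by (metis coprime_diff_one_left)
  thus "coprime (sign_tuple r S s) (int r)" for s by (simp add: sign_tuple_def)
qed (use assms in \<open>auto simp: sign_tuple_def\<close>)

lemma coprime_sign_ratio: "coprime (sign_ratio S s) (int r)"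
  by (simp add: sign_ratio_def)

lemma path_matrix_sign:
  assumes "r > 2"
  shows "path_matrix r (units_tuple.ratio r (sign_tuple r S)) = path_matrix r (sign_ratio S)"
proof -
  let ?m = "sign_tuple r S"
  interpret units_tuple r ?m by (rule units_tuple_sign[OF assms])
  have sign: "[?m s = (if s \<in> S then - 1 else 1)] (mod int r)" for s
    by (simp add: sign_tuple_def cong_def)
  have "[ratio s = sign_ratio S s] (mod int r)" for s
  proof -
    \<comment> \<open>Each sign is its own inverse, so multiplying by its square turns the quotient
      of two signs into their product.\<close>
    have "[ratio s * 1 = ratio s * (?m (Suc s) * ?m (Suc s))] (mod int r)"
      using cong_mult[OF sign[of "Suc s"] sign[of "Suc s"]]
      by (intro cong_mult cong_refl) (auto simp: cong_sym split: if_splits)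
    also have "ratio s * (?m (Suc s) * ?m (Suc s)) = ?m s * ?m (Suc s) * (?m (Suc s) * inverse_unit (Suc s))"
      by (simp add: ratio_def)
    also have "[\<dots> = ?m s * ?m (Suc s) * 1] (mod int r)" by (intro cong_mult inverse_unit cong_refl)
    also have "[?m s * ?m (Suc s) * 1 = sign_ratio S s] (mod int r)"
      using cong_mult[OF sign[of s] sign[of "Suc s"]] by (auto simp: sign_ratio_def split: if_splits)
    finally show ?thesis by simp
  qed
  hence "chain_count r ratio d s x = chain_count r (sign_ratio S) d s x" for d s x
    by (intro chain_count_cong)
  thus ?thesis by (intro ext) (simp add: path_matrix_def)
qed

lemma phi_gt_1_sign:
  assumes "r > 2" "\<not> fun_cong n (path_matrix r (sign_ratio S)) (path_matrix r (sign_ratio T))"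
  shows "1 < phi r n"
proof -
  have "\<not> mat_sim n (B_mat r n (sign_tuple r S)) (B_mat r n (sign_tuple r T))"
    using assms units_tuple_sign[OF assms(1)] by (simp add: mat_sim_B_mat_iff path_matrix_sign)
  moreover have "B_mat r n (sign_tuple r S) \<in> S_set r n" for S
    using units_tuple_sign[OF assms(1)] by (simp add: S_set_eq[OF assms(1)])
  ultimately show ?thesis unfolding phi_gt_1_iff[OF assms(1)] by blast
qed

lemma phi_le_1I:
  assumes "r > 2"
    and "\<And>w w'. (\<And>s. coprime (w s) (int r)) \<Longrightarrow> (\<And>s. coprime (w' s) (int r)) \<Longrightarrow>
      fun_cong n (path_matrix r w) (path_matrix r w')"
  shows "\<not> 1 < phi r n"
  unfolding phi_gt_1_iff[OF assms(1)] S_set_eq[OF assms(1)]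
  using assms(2) by (auto simp: mat_sim_B_mat_iff units_tuple.coprime_ratio)

text \<open>In the product of the fractions \<open>(r + i) / i\<close> for \<open>0 < i\<close> and
  \<open>i \<le> j\<close>, no numerator is divisible by \<open>p\<close>, since
  \<open>r + i\<close> is \<open>i\<close> modulo \<open>p\<close>.\<close>

lemma prime_not_dvd_binomial:
  assumes "prime p" "p dvd r" "j < p"
  shows "\<not> p dvd ((r + j) choose j)"
  using assms(3)
proof (induction j)
  case 0
  then show ?case using assms(1) by (auto simp: not_prime_1)
next
  case (Suc j)
  show ?case
  proof
    assume "p dvd ((r + Suc j) choose Suc j)"
    hence "p dvd Suc j * ((r + Suc j) choose Suc j)" by simp
    also have "Suc j * ((r + Suc j) choose Suc j) = (r + Suc j) * ((r + j) choose j)"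
      by (subst binomial_absorption) simp
    finally have "p dvd (r + Suc j) * ((r + j) choose j)" .
    moreover have "\<not> p dvd ((r + j) choose j)" using Suc by simp
    ultimately have "p dvd r + Suc j" using assms(1) prime_dvd_mult_iff by blast
    hence "p dvd Suc j" using assms(2) dvd_add_right_iff by blast
    thus False using Suc.prems by (auto dest: dvd_imp_le)
  qed
qed

text \<open>Reflecting the position on level 2 by \<open>y \<mapsto> -y\<close> turns the weight \<open>y\<close> of the remaining chain
  into \<open>r - y\<close>, so the two counts cancel modulo \<open>r\<close>.\<close>

lemma chain_count_flip_sum:
  assumes "r > 0"
  shows "int r dvd chain_count r (sign_ratio {}) (Suc (Suc d)) 1 1 + chain_count r (sign_ratio {2}) (Suc (Suc d)) 1 1"
proof -
  let ?w = "sign_ratio {}" and ?w' = "sign_ratio {2}"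
  \<comment> \<open>The sign at level 2 changes the ratios of levels 1 and 2. The former drops out
    at starting position 1, and from level 3 on the two tails coincide.\<close>
  define f where "f x = chain_count r ?w d 3 x" for x
  have f': "chain_count r ?w' d 3 x = f x" for x
    unfolding f_def by (rule chain_count_cong) (auto simp: sign_ratio_def)
  have "chain_count r ?w (Suc (Suc d)) 1 1 = (\<Sum>y = 1..r. int y * f (rep r (int y * ?w 2)))"
    using chain_count_from_1'[of r ?w 1 d] assms coprime_sign_ratio by (simp add: f_def numeral_eq_Suc)
  also have "\<dots> = (\<Sum>y = 1..r. int y * f y)"
    using rep_id[OF assms] by (intro sum.cong) (auto simp: sign_ratio_def)
  finally have A: "chain_count r ?w (Suc (Suc d)) 1 1 = (\<Sum>y = 1..r. int y * f y)" .
  have "chain_count r ?w' (Suc (Suc d)) 1 1 = (\<Sum>y = 1..r. int y * f (rep r (int y * - 1)))"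
    using chain_count_from_1'[of r ?w' 1 d] assms coprime_sign_ratio
    by (simp add: f'[symmetric] numeral_eq_Suc sign_ratio_def)
  also have "\<dots> = (\<Sum>y = 1..r. int (rep r (int y * - 1)) * f (rep r (int (rep r (int y * - 1)) * - 1)))"
    using sum_rep[OF assms, of "- 1" "\<lambda>y. int y * f (rep r (int y * - 1))"] by simp
  also have "\<dots> = (\<Sum>y = 1..r. int (rep r (- int y)) * f y)"
  proof (intro sum.cong refl)
    fix y assume y: "y \<in> {1..r}"
    have "[int (rep r (int y * - 1)) * - 1 = (int y * - 1) * - 1] (mod int r)"
      by (intro cong_mult cong_refl rep_cong assms)
    hence "rep r (int (rep r (int y * - 1)) * - 1) = y"
      using rep_eqI[OF assms y] by (simp add: cong_sym)
    thus "int (rep r (int y * - 1)) * f (rep r (int (rep r (int y * - 1)) * - 1)) = int (rep r (- int y)) * f y"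
      by simp
  qed
  finally have "chain_count r ?w (Suc (Suc d)) 1 1 + chain_count r ?w' (Suc (Suc d)) 1 1
      = (\<Sum>y = 1..r. (int y + int (rep r (- int y))) * f y)"
    unfolding A by (simp add: sum.distrib distrib_right del: chain_count.simps)
  also have "int r dvd \<dots>"
  proof (intro dvd_sum dvd_mult2)
    fix y
    have "[int y + int (rep r (- int y)) = int y + - int y] (mod int r)"
      by (intro cong_add cong_refl rep_cong assms)
    thus "int r dvd int y + int (rep r (- int y))" by (simp add: cong_0_iff)
  qed
  finally show ?thesis .
qed

text \<open>The corners agree modulo \<open>k\<close> if the matrices are equivalent, but they are
  negatives of each other modulo \<open>k\<close>. As \<open>k\<close> is odd, it would divide
  \<open>(r + p - 1) choose p\<close>, in which \<open>p\<close> occurs once less often than in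
  \<open>r\<close>.\<close>

lemma not_fun_cong_prime:
  assumes "r = 2 ^ v * k" "odd k" "prime p" "odd p" "p dvd k"
    and "\<And>q :: nat. prime q \<Longrightarrow> q dvd k \<Longrightarrow> p \<le> q"
  shows "\<not> fun_cong (Suc p) (path_matrix r (sign_ratio {})) (path_matrix r (sign_ratio {2}))"
proof
  let ?C = "path_matrix r (sign_ratio {})" and ?C' = "path_matrix r (sign_ratio {2})"
  assume "fun_cong (Suc p) ?C ?C'"
  have k: "k > 0" using assms(2) by (cases k) auto
  hence "r > 0" using assms(1) by simp
  have "k dvd r" using assms(1) by simp
  have "p > 2" using assms(3,4) prime_ge_2_nat[of p] by (cases "p = 2") auto
  have dvd: "int k dvd path_matrix r w i j" if "i < j" "j - i < p" for w i j
    using path_matrix_dvd[OF \<open>r > 0\<close> \<open>k dvd r\<close> assms(6)] that by blast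
  have "int k dvd ?C 0 p - ?C' 0 p"
    using \<open>fun_cong (Suc p) ?C ?C'\<close> \<open>p > 2\<close> by (intro fun_cong_corner dvd) auto
  moreover have "int r dvd ?C 0 p + ?C' 0 p"
    using chain_count_flip_sum[OF \<open>r > 0\<close>, of "p - 2"] \<open>p > 2\<close>
    by (simp add: path_matrix_def Suc_diff_Suc numeral_2_eq_2 del: chain_count.simps)
  hence "int k dvd ?C 0 p + ?C' 0 p" using \<open>k dvd r\<close> by (meson dvd_trans of_nat_dvd_iff)
  ultimately have "int k dvd (?C 0 p - ?C' 0 p) + (?C 0 p + ?C' 0 p)" by (rule dvd_add)
  hence "int k dvd 2 * ?C 0 p" by (simp add: algebra_simps)
  moreover have "coprime (int k) 2" using assms(2) by simp
  ultimately have "int k dvd ?C 0 p" using coprime_dvd_mult_right_iff by blast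
  moreover have "?C 0 p = int ((r - 1 + p) choose p)"
    using chain_count_ones[of 1 "sign_ratio {}" 1 r p] \<open>r > 0\<close> \<open>p > 2\<close>
    by (simp add: path_matrix_def sign_ratio_def)
  moreover have "r - 1 + p = r + (p - 1)" using \<open>r > 0\<close> \<open>p > 2\<close> by simp
  ultimately have "k dvd ((r + (p - 1)) choose p)" by simp
  then obtain a where a: "(r + (p - 1)) choose p = k * a" by blast
  have "p * ((r + (p - 1)) choose p) = r * ((r + (p - 1)) choose (p - 1))"
    using binomial_absorption[of "p - 1" "r + (p - 1)"] binomial_absorb_comp[of "r + (p - 1)" "p - 1"] \<open>p > 2\<close>
    by simp
  \<comment> \<open>Cancelling \<open>k\<close> removes every factor \<open>p\<close> of
    \<open>r\<close>, so \<open>p\<close> would have to divide a number prime to it.\<close>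
  hence "k * (p * a) = k * (2 ^ v * ((r + (p - 1)) choose (p - 1)))"
    unfolding a using assms(1) by (simp add: algebra_simps)
  hence "p * a = 2 ^ v * ((r + (p - 1)) choose (p - 1))" using k by simp
  hence "p dvd 2 ^ v * ((r + (p - 1)) choose (p - 1))" by (metis dvd_triv_left)
  moreover have "\<not> p dvd 2 ^ v"
    using assms(3) \<open>p > 2\<close> prime_dvd_power[of p 2 v] dvd_imp_le[of p 2] by auto
  moreover have "p dvd r" using assms(5) \<open>k dvd r\<close> dvd_trans by blast
  hence "\<not> p dvd ((r + (p - 1)) choose (p - 1))"
    using \<open>p > 2\<close> by (intro prime_not_dvd_binomial assms(3)) auto
  ultimately show False using assms(3) prime_dvd_mult_iff by blast
qed

lemma binomial_5: "120 * ((r + 4) choose 5) = r * (r + 1) * (r + 2) * (r + 3) * (r + 4 :: nat)"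
proof -
  have absorb: "a * ((r + b) choose a) = (r + b) * ((r + c) choose d)"
    if "a = Suc d" "b = Suc c" for a b c d
    using that binomial_absorption[of d "r + b"] by simp
  have b: "5 * ((r + 4) choose 5) = (r + 4) * ((r + 3) choose 4)"
    "4 * ((r + 3) choose 4) = (r + 3) * ((r + 2) choose 3)"
    "3 * ((r + 2) choose 3) = (r + 2) * ((r + 1) choose 2)"
    "2 * ((r + 1) choose 2) = (r + 1) * ((r + 0) choose 1)"
    by (rule absorb; simp)+
  have "120 * ((r + 4) choose 5) = 24 * (5 * ((r + 4) choose 5))" by simp
  also have "\<dots> = 6 * (r + 4) * (4 * ((r + 3) choose 4))" unfolding b(1) by simp
  also have "\<dots> = 2 * (r + 4) * (r + 3) * (3 * ((r + 2) choose 3))" unfolding b(2) by simp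
  also have "\<dots> = (r + 4) * (r + 3) * (r + 2) * (2 * ((r + 1) choose 2))" unfolding b(3) by (simp only: mult_ac)
  also have "\<dots> = r * (r + 1) * (r + 2) * (r + 3) * (r + 4)" unfolding b(4) by (simp only: mult_ac choose_one add_0_right)
  finally show ?thesis .
qed

text \<open>The summand is the doubled weight \<open>y * (y + 1)\<close> times the doubled tail
  count \<open>(y + 1) * (y + 2)\<close> of \<open>corner_flip_2_3\<close>.\<close>

lemma flip_sum_formula:
  "10 * (\<Sum>y = 1..r. int y * (int y + 1) * ((int y + 1) * (int y + 2)))
    = int r * (int r + 1) * (int r + 2) * (int r + 3) * (2 * int r + 3)"
  by (induction r) (simp_all add: algebra_simps)

text \<open>The ratio of level 1 drops out, that of level 2 is 1, and level 3 reflects the position,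
  after which the tail is a binomial coefficient.\<close>

lemma corner_flip_2_3:
  assumes "r > 0"
  shows "40 * chain_count r (sign_ratio {2, 3}) 5 1 1
    = int r * (int r + 1) * ((int r - 1) * (int r + 2) * (2 * int r + 1) + 20)"
proof -
  let ?w = "sign_ratio {2, 3}"
  have w: "?w 2 = 1" "?w 3 = - 1" "\<And>s. s \<ge> 4 \<Longrightarrow> ?w s = 1" by (auto simp: sign_ratio_def)
  have "chain_count r ?w 5 1 1 = (\<Sum>y = 1..r. int y * chain_count r ?w 3 3 (rep r (int y * ?w 2)))"
    using chain_count_from_1'[of r ?w 1 3] assms coprime_sign_ratio by (simp add: numeral_eq_Suc)
  also have "\<dots> = (\<Sum>y = 1..r. int y * chain_count r ?w 3 3 y)"
    using rep_id[OF assms] by (intro sum.cong) (auto simp: w(1))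
  also have "\<dots> = (\<Sum>y = 1..r. (\<Sum>x = 1..y. int x) * chain_count r ?w 2 4 (rep r (int y * ?w 3)))"
    using sum_tail_swap[of int "\<lambda>y. chain_count r ?w 2 4 (rep r (int y * ?w 3))" r]
    by (simp add: numeral_eq_Suc)
  also have "\<dots> = (\<Sum>y = 1..r. (\<Sum>x = 1..y. int x) * int ((r - rep r (- int y) + 2) choose 2))"
    using rep_range[OF assms] w(3) by (intro sum.cong refl arg_cong2[of _ _ _ _ "(*)"])
      (simp add: w(2) chain_count_ones del: chain_count.simps)
  finally have eq: "chain_count r ?w 5 1 1
    = (\<Sum>y = 1..r. (\<Sum>x = 1..y. int x) * int ((r - rep r (- int y) + 2) choose 2))" .
  \<comment> \<open>The term \<open>y = r\<close> is split off: reflection sends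
    \<open>y < r\<close> to \<open>r - y\<close> but fixes \<open>r\<close>, the code of the
    0-vertex. This exceptional term produces the summand 20.\<close>
  obtain r' where r': "r = Suc r'" using assms by (cases r) auto
  have choose: "2 * int ((y + 2) choose 2) = (int y + 1) * (int y + 2)" for y
  proof -
    have "2 * ((y + 2) choose 2) = (y + 2) * (y + 1)"
      using binomial_absorption[of 1 "y + 2"] by (simp add: numeral_2_eq_2)
    hence "int (2 * ((y + 2) choose 2)) = int ((y + 2) * (y + 1))" by simp
    thus ?thesis by (simp add: algebra_simps)
  qed
  have rep_minus: "r - rep r (- int y) = y" if "y \<in> {1..r'}" for y
  proof -
    have "rep r (- int y) = r - y"
      using that r' by (intro rep_eqI) (auto simp: cong_def of_nat_diff)
    thus ?thesis using that r' by auto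
  qed
  have rep_last: "rep r (- int r) = r" using rep_multiple[OF assms, of "- 1"] by simp
  have "4 * chain_count r ?w 5 1 1
    = (\<Sum>y = 1..r. (2 * (\<Sum>x = 1..y. int x)) * (2 * int ((r - rep r (- int y) + 2) choose 2)))"
  proof -
    have "4 * (a * b) = (2 * a) * (2 * b)" for a b :: int by simp
    thus ?thesis unfolding eq by (subst sum_distrib_left) (intro sum.cong refl)
  qed
  also have "\<dots> = (\<Sum>y = 1..r. int y * (int y + 1) * (2 * int ((r - rep r (- int y) + 2) choose 2)))"
    unfolding gauss_sum_int ..
  also have "\<dots> = (\<Sum>y = 1..r'. int y * (int y + 1) * (2 * int ((r - rep r (- int y) + 2) choose 2)))
      + int r * (int r + 1) * (2 * int ((r - rep r (- int r) + 2) choose 2))"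
    by (subst (1) r', subst sum.cl_ivl_Suc) (simp add: r')
  also have "int ((r - rep r (- int r) + 2) choose 2) = 1" by (simp add: rep_last numeral_2_eq_2)
  also have "(\<Sum>y = 1..r'. int y * (int y + 1) * (2 * int ((r - rep r (- int y) + 2) choose 2)))
      = (\<Sum>y = 1..r'. int y * (int y + 1) * ((int y + 1) * (int y + 2)))"
    by (intro sum.cong refl) (simp only: rep_minus choose)
  finally have "40 * chain_count r ?w 5 1 1
      = int r' * (int r' + 1) * (int r' + 2) * (int r' + 3) * (2 * int r' + 3) + 20 * (int r * (int r + 1))"
    using flip_sum_formula[of r'] by simp
  also have "\<dots> = int r * (int r + 1) * ((int r - 1) * (int r + 2) * (2 * int r + 1) + 20)"
    unfolding r' by (simp add: algebra_simps)
  finally show ?thesis .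
qed

text \<open>The corner of the constant tuple is divisible by \<open>2 * 2 ^ u\<close>, thanks to the
  factors of two in \<open>r\<close>, \<open>r + 2\<close> and \<open>r + 4\<close>. The other
  corner is an odd multiple of \<open>2 ^ u\<close>, so the invariant tells them apart.\<close>

lemma not_fun_cong_6:
  assumes "r = 4 * 2 ^ u * k" "odd k"
  shows "\<not> fun_cong 6 (path_matrix r (sign_ratio {})) (path_matrix r (sign_ratio {2, 3}))"
proof
  let ?C = "path_matrix r (sign_ratio {})" and ?C' = "path_matrix r (sign_ratio {2, 3})"
  let ?q = "2 ^ u :: int"
  assume cong: "fun_cong 6 ?C ?C'"
  have k: "k > 0" using assms(2) by (cases k) auto
  hence "r > 0" using assms(1) by simp
  have r: "int r = 4 * ?q * int k" "r = 2 ^ (u + 2) * k" using assms(1) by simp_all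
  define e where "e = 2 * ?q * int k * (int r + 1)"
  have second: "path_matrix r (sign_ratio S) i (i + 2) = e" for S i
  proof -
    have "2 * path_matrix r (sign_ratio S) i (i + 2) = 2 * e"
      unfolding path_matrix_2[OF \<open>r > 0\<close> coprime_sign_ratio] by (simp add: e_def r(1))
    thus ?thesis by simp
  qed
  have e4: "\<not> 4 * ?q dvd e"
  proof
    assume "4 * ?q dvd e"
    hence "2 * ?q * 2 dvd 2 * ?q * (int k * (int r + 1))" by (simp add: e_def mult_ac)
    hence "even (int k * (int r + 1))" by (subst (asm) dvd_mult_cancel_left) auto
    thus False using assms(2) r(1) by simp
  qed
  have e2: "2 * ?q dvd e" unfolding e_def by simp
  have third: "4 * ?q dvd path_matrix r (sign_ratio S) i (i + 3)" for S i
    using path_matrix_3_dvd[OF r(2) _ k] coprime_sign_ratio by simp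
  have fourth: "2 * ?q dvd ?C 1 5 - ?q" "2 * ?q dvd ?C' 0 4 - ?q"
    using path_matrix_4_cong[OF assms, of "sign_ratio {}" 1]
      path_matrix_4_cong[OF assms, of "sign_ratio {2, 3}" 0] coprime_sign_ratio by simp_all
  have "4 * ?q dvd int r" unfolding r(1) by (rule dvd_triv_left)
  hence "2 * ?q dvd ?C 0 5 - ?C' 0 5"
    using \<open>r > 0\<close> by (intro fun_cong_corner_6[where r = "int r" and e = e, OF cong _ _ _
      path_matrix_1 path_matrix_1 second second e2 e4 third third fourth]) simp_all
  moreover have "2 * ?q dvd ?C 0 5"
  proof -
    have "?C 0 5 = int ((r + 4) choose 5)"
    proof -
      have "chain_count r (sign_ratio {}) 5 1 1 = int ((r - 1 + 5) choose 5)"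
        using \<open>r > 0\<close> by (intro chain_count_ones) (auto simp: sign_ratio_def)
      moreover have "r - 1 + 5 = r + 4" using \<open>r > 0\<close> by simp
      ultimately show ?thesis by (simp only: path_matrix_def) simp
    qed
    hence "120 * ?C 0 5 = int (120 * ((r + 4) choose 5))" by simp
    also have "\<dots> = int r * (int r + 1) * (int r + 2) * (int r + 3) * (int r + 4)"
      unfolding binomial_5 by (simp add: algebra_simps)
    also have "\<dots> = 8 * (2 * ?q * (2 * int k * (int r + 1) * (2 * ?q * int k + 1) * (int r + 3) * (?q * int k + 1)))"
    proof -
      have *: "int r + 2 = 2 * (2 * ?q * int k + 1)" "int r + 4 = 4 * (?q * int k + 1)"
        unfolding r(1) by simp_all
      have "4 * ?q * int k * x * (2 * y) * z * (4 * t) = 8 * (2 * ?q * (2 * int k * x * y * z * t))"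
        for x y z t by simp
      hence "int r * x * (2 * y) * z * (4 * t) = 8 * (2 * ?q * (2 * int k * x * y * z * t))"
        for x y z t by (simp only: r(1))
      thus ?thesis unfolding * .
    qed
    finally have "15 * ?C 0 5 = 2 * ?q * (2 * int k * (int r + 1) * (2 * ?q * int k + 1) * (int r + 3) * (?q * int k + 1))"
      by simp
    hence "2 ^ Suc u dvd 15 * ?C 0 5" by simp
    hence "2 ^ Suc u dvd ?C 0 5" by (rule dvd_of_odd_multiple) simp
    thus ?thesis by simp
  qed
  ultimately have "2 * ?q dvd ?C' 0 5" by (metis diff_diff_eq2 add_diff_cancel_left' dvd_diff)
  then obtain t where t: "?C' 0 5 = 2 * ?q * t" by blast
  define U where "U = (int r - 1) * (2 * ?q * int k + 1) * (2 * int r + 1) + 10"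
  have "(int r - 1) * (int r + 2) * (2 * int r + 1) + 20 = 2 * U"
    unfolding U_def r(1) by (simp add: algebra_simps)
  hence "40 * ?C' 0 5 = int r * (int r + 1) * (2 * U)"
    using corner_flip_2_3[OF \<open>r > 0\<close>] by (simp add: path_matrix_def del: chain_count.simps)
  hence "8 * ?q * (10 * t) = 8 * ?q * (int k * (int r + 1) * U)"
    unfolding t r(1) by (simp add: algebra_simps)
  hence "10 * t = int k * (int r + 1) * U" by simp
  moreover have "odd U" unfolding U_def r(1) by simp
  ultimately show False using assms(2) r(1) by (metis even_add even_mult_iff even_numeral even_of_nat_iff odd_one)
qed

theorem theorem5p1:
  fixes r p :: nat
  assumes "r > 2"
    and "p = (LEAST q. prime q \<and> odd q \<and> q dvd r)"
  shows "phi_tilde r =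
    (if \<not> 4 dvd r then p + 1
     else if \<exists>q. prime q \<and> odd q \<and> q dvd r then min 6 (p + 1)
     else 6)"
proof -
  obtain k where "r = 2 ^ multiplicity 2 r * k" "\<not> 2 dvd k"
    using multiplicity_decompose'[of r 2] assms(1) by auto
  then obtain v where vk: "r = 2 ^ v * k" "odd k" by blast
  have "k > 0" "r > 0" using vk(2) assms(1) by (cases k, auto)
  have least: "phi_tilde r = N"
    if "N > 0" "1 < phi r N" "\<And>n. 0 < n \<Longrightarrow> n < N \<Longrightarrow> \<not> 1 < phi r n" for N
    unfolding phi_tilde_def using that by (intro Least_equality) (auto simp: not_less[symmetric])
  have p: "prime p" "odd p" "p dvd k" "\<And>q. prime q \<Longrightarrow> q dvd k \<Longrightarrow> p \<le> q"
    if "\<exists>q. prime q \<and> odd q \<and> q dvd r"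
  proof -
    have *: "prime p \<and> odd p \<and> p dvd r" unfolding assms(2) using that by (rule LeastI_ex)
    thus "prime p" "odd p" by auto
    have "\<not> p dvd 2 ^ v" using * prime_dvd_power_nat[of p 2 v] primes_dvd_imp_eq[of p 2] by auto
    thus "p dvd k" using * vk(1) prime_dvd_mult_iff by blast
    show "p \<le> q" if "prime q" "q dvd k" for q
      unfolding assms(2) using that vk by (intro Least_le) (auto dest: dvd_trans)
  qed
  have at_prime: "1 < phi r (p + 1)" if "\<exists>q. prime q \<and> odd q \<and> q dvd r"
    using phi_gt_1_sign[OF assms(1) not_fun_cong_prime[OF vk p[OF that]]] by simp
  show ?thesis
  proof (cases "4 dvd r")
    case False
    have "v < 2"
    proof (rule ccontr)
      assume "\<not> v < 2"
      hence "(2 :: nat) ^ 2 dvd 2 ^ v" by (intro le_imp_power_dvd) simp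
      thus False using False vk(1) by (simp add: dvd_mult2)
    qed
    hence "v = 0 \<or> v = 1" by auto
    hence r: "r = k \<or> r = 2 * k" using vk(1) by auto
    \<comment> \<open>Here \<open>r > 2\<close> guarantees an odd prime divisor.\<close>
    have "k \<noteq> 1" using r assms(1) by auto
    then obtain q where "prime q" "q dvd k" using prime_factor_nat by blast
    hence ex: "\<exists>q. prime q \<and> odd q \<and> q dvd r" using vk by (auto dest: dvd_trans)
    have "phi_tilde r = p + 1"
    proof (rule least[OF _ at_prime[OF ex]])
      fix n assume "n < p + 1"
      thus "\<not> 1 < phi r n"
        using fun_cong_if_not_4_dvd[OF \<open>r > 0\<close> _ _ r vk(2) p(4)[OF ex]]
        by (intro phi_le_1I[OF assms(1)]) auto
    qed simp
    thus ?thesis using False by simp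
  next
    case True
    have "v \<ge> 2"
    proof (rule ccontr)
      assume "\<not> v \<ge> 2"
      hence "v = 0 \<or> v = 1" by auto
      hence "r = k \<or> r = 2 * k" using vk(1) by auto
      thus False using True vk(2) by presburger
    qed
    then obtain u where "v = u + 2" by (metis add.commute le_Suc_ex)
    hence r: "r = 4 * 2 ^ u * k" using vk(1) by (simp add: power_add)
    show ?thesis
    \<comment> \<open>If \<open>p = 3\<close>, size 4 already decides. Otherwise all prime factors
      of \<open>k\<close> are at least 5, so \<open>p + 1\<close> is at least 6 whenever an odd
      prime divisor exists. Without one the \<open>LEAST\<close> value \<open>p\<close> is
      unspecified, hence the guard.\<close>
    proof (cases "(\<exists>q. prime q \<and> odd q \<and> q dvd r) \<and> p = 3")
      case p3: True
      have "phi_tilde r = p + 1"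
      proof (rule least[OF _ at_prime])
        fix n assume "n < p + 1"
        thus "\<not> 1 < phi r n"
          using fun_cong_if_le_3[OF \<open>r > 0\<close>] p3 by (intro phi_le_1I[OF assms(1)]) auto
      qed (use p3 in auto)
      thus ?thesis using True p3 by simp
    next
      case not3: False
      have large: "5 \<le> q" if "prime q" "q dvd k" for q
      proof -
        have "odd q" "q dvd r" using that vk by (auto dest: dvd_trans)
        hence ex: "\<exists>q. prime q \<and> odd q \<and> q dvd r" using that by blast
        have "p \<le> q" "p \<noteq> 3" "odd p" "prime p" using p[OF ex] that not3 ex by auto
        moreover have "p \<noteq> 1" using \<open>prime p\<close> by auto
        ultimately show ?thesis by presburger
      qed
      have "phi_tilde r = 6"
      proof (rule least)
        show "1 < phi r 6" by (rule phi_gt_1_sign[OF assms(1) not_fun_cong_6[OF r vk(2)]])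
        fix n :: nat assume "n < 6"
        thus "\<not> 1 < phi r n"
          using fun_cong_if_4_dvd[OF r vk(2) _ _ large] by (intro phi_le_1I[OF assms(1)]) auto
      qed simp
      moreover have "p \<ge> 5" if "\<exists>q. prime q \<and> odd q \<and> q dvd r"
        using large p[OF that] by blast
      ultimately show ?thesis using True by auto
    qed
  qed
qed

end
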